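(* Let $s,t\ge 1$, let $a_1,\dots,a_s,b_1,\dots,b_t\in\mathbb{Z}\setminus\{0\}$, and suppose that there exists a non-empty set $I\subset\{1,\dots,s\}$ such that $\sum_{i\in I}a_i=0$. For every positive integer $r$ there exist a constant $c>0$ and a function $\tau:\mathbb{N}\to[0,\infty)$ with $\tau(N)\to0$ as $N\to\infty$, both depending only on $r$ and on the coefficients $a_i,b_j$ (including $s,t$), such that the following holds for every positive integer $N$. For any $r$-colouring $C_1\cup\dots\cup C_r=\{1,\dots,N\}$ there exists a colour class $C_j$ such that $$\sum_{a_1x_1+\dots+a_sx_s=b_1y_1^2+\dots+b_ty_t^2}1_{C_j}(x_1)\cdots1_{C_j}(x_s)\,1_{C_j}(y_1)\cdots1_{C_j}(y_t)\ \ge\ c\,N^{(|I|+s+t-2)/2^r}(1-\tau(N)),$$ where the sum is over all integer tuples $(x_1,\dots,x_s,y_1,\dots,y_t)$ satisfying the indicated equation.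
   Context: $\mathbb{N}$ denotes the positive integers. An $r$-colouring of a set is a partition of it into $r$ (possibly empty) parts, called colour classes. $1_C$ denotes the indicator function of $C$. *)

theory Defs
  imports "HOL-Analysis.Analysis"
begin

text \<open>The classes are indexed by \<open>{1..r}\<close>, and some of them may be empty.\<close>

definition colouring :: "nat \<Rightarrow> 'a set \<Rightarrow> (nat \<Rightarrow> 'a set) \<Rightarrow> bool" where
  "colouring r S C \<longleftrightarrow> (\<Union>j\<in>{1..r}. C j) = S \<and> disjoint_family_on C {1..r}"

text \<open>A tuple in \<open>\<int>\<^sup>s\<close> is an integer-valued function that is extensional on \<open>{1..s}\<close>,
  so distinct functions are distinct tuples.\<close>

definition solutions ::
    "nat \<Rightarrow> nat \<Rightarrow> (nat \<Rightarrow> int) \<Rightarrow> (nat \<Rightarrow> int) \<Rightarrow> ((nat \<Rightarrow> int) \<times> (nat \<Rightarrow> int)) set" where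
  "solutions s t a b =
     {(x, y). x \<in> {1..s} \<rightarrow>\<^sub>E UNIV \<and> y \<in> {1..t} \<rightarrow>\<^sub>E UNIV \<and>
        (\<Sum>i\<in>{1..s}. a i * x i) = (\<Sum>j\<in>{1..t}. b j * (y j)\<^sup>2)}"

text \<open>The index set is in general infinite, so an unordered sum \<open>infsum\<close> is used
  (\<open>sum\<close> would be 0). For finite \<open>A\<close> only finitely many terms are nonzero.\<close>

definition solution_count ::
    "nat \<Rightarrow> nat \<Rightarrow> (nat \<Rightarrow> int) \<Rightarrow> (nat \<Rightarrow> int) \<Rightarrow> int set \<Rightarrow> real" where
  "solution_count s t a b A =
     (\<Sum>\<^sub>\<infinity>(x, y)\<in>solutions s t a b.
        (\<Prod>i\<in>{1..s}. indicator A (x i)) * (\<Prod>j\<in>{1..t}. indicator A (y j)))"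

end

theory Submission
  imports Defs "HOL-Library.Multiset_Order" "HOL-Library.Function_Algebras"
    "HOL-Computational_Algebra.Polynomial"
begin

text \<open>The proof is elementary and combines a Brauer-type induction on the number of colours with the
polynomial van der Waerden theorem. No explicit constants are claimed, so it is enough to find
\<open>c * N powr (e / 2 ^ r)\<close> monochromatic solutions for all large \<open>N\<close>, where
\<open>e = card I + s + t - 2\<close>; for small \<open>N\<close> one puts \<open>\<tau> N = 1\<close>.

The solutions are produced by finitely many polynomial identities. Consider integer vectors \<open>g\<close>
whose coordinates \<open>g l\<close> run through intervals of length \<open>B ^ \<omega> l\<close>. A Ramsey system for \<open>r\<close> colours
is a finite set \<open>W\<close> of polynomial functions of \<open>g\<close>, with values of size \<open>O(B ^ k)\<close>, such that for
every \<open>g\<close> each \<open>r\<close>-colouring of the numbers \<open>w g\<close> (\<open>w \<in> W\<close>) contains a monochromatic solution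
which belongs to an identity between members of \<open>W\<close>. Moreover, such a solution determines \<open>g\<close> once
some coordinates are known, and the other coordinates have total weight at least \<open>e\<close>. Hence a
solution arises from at most a proportion \<open>B ^ (- e)\<close> of all \<open>g\<close>, and double counting gives a
constant times \<open>B ^ e\<close> solutions in \<open>{1..O(B ^ k)}\<close>. With \<open>k = 2 ^ r\<close> this is the asserted bound
(\<open>many_monochromatic_solutions\<close>).

The exponent doubles with each colour (\<open>Ramsey_system_Suc\<close>). Take one independent copy of a system
for \<open>r\<close> colours for each variable \<open>y j\<close> and each \<open>x i\<close> with \<open>i \<notin> I\<close>, and add new coordinates of
weight \<open>2 * k\<close>, the size of a square of an element of a copy. Whatever elements \<open>z\<close> one picks in the
copies, let \<open>n z\<close> be the value that \<open>(\<Sum>i\<in>I. a i * x i)\<close> must then have. Once all of \<open>z\<close> is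
divisible by some \<open>a i\<close> with \<open>i \<in> I\<close>, this value is attained at suitable polynomials \<open>f i\<close>
without constant term, and also at \<open>x i = v + f i\<close> for every \<open>v\<close>, as the \<open>a i\<close> with \<open>i \<in> I\<close> sum
to 0. The polynomial
van der Waerden theorem provides, after dilating \<open>g\<close> by a bounded factor, a base point \<open>v\<close> for which
all the numbers \<open>v + f i\<close>, for all choices of \<open>z\<close> at once, have one colour \<open>\<gamma>\<close>. If some copy
avoids \<open>\<gamma>\<close>, it is coloured with \<open>r\<close> colours and contains a solution. Otherwise every copy has an
element of colour \<open>\<gamma>\<close>, and choosing these as \<open>z\<close> completes a solution of colour \<open>\<gamma>\<close>.

The van der Waerden theorem is proved over an arbitrary commutative ring, by colour focusing and
induction on the leading coefficients (\<open>polynomial_van_der_Waerden\<close>). It is applied to the ring of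
all functions of \<open>g\<close>, which makes the bounds and the finite set of candidates for \<open>v\<close>
independent of \<open>g\<close>.\<close>

section \<open>A polynomial van der Waerden theorem over commutative rings\<close>

definition additive_subgroup :: "'a::comm_ring_1 set \<Rightarrow> bool" where
  "additive_subgroup H \<longleftrightarrow> 0 \<in> H \<and> (\<forall>x\<in>H. \<forall>y\<in>H. x + y \<in> H) \<and> (\<forall>x\<in>H. - x \<in> H)"

lemma additive_subgroup_diff: "additive_subgroup H \<Longrightarrow> x \<in> H \<Longrightarrow> y \<in> H \<Longrightarrow> x - y \<in> H"
  unfolding additive_subgroup_def by (metis diff_conv_add_uminus)

lemma additive_subgroup_of_nat_mult: "additive_subgroup H \<Longrightarrow> x \<in> H \<Longrightarrow> of_nat n * x \<in> H"
  by (induction n) (auto simp: additive_subgroup_def algebra_simps)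

lemma additive_subgroup_sum:
  "additive_subgroup H \<Longrightarrow> (\<And>i. i \<in> T \<Longrightarrow> f i \<in> H) \<Longrightarrow> sum f T \<in> H"
  by (induction T rule: infinite_finite_induct) (auto simp: additive_subgroup_def)

lemma poly_of_nat_in_subgroup:
  assumes "additive_subgroup H" "\<And>i. coeff p i \<in> H"
  shows "poly p (of_nat d) \<in> H"
proof -
  have "coeff p i * of_nat d ^ i \<in> H" for i
    using additive_subgroup_of_nat_mult[OF assms(1) assms(2)[of i], of "d ^ i"]
    by (simp add: mult.commute)
  then show ?thesis
    unfolding poly_altdef by (intro additive_subgroup_sum assms(1))
qed

definition shift :: "'a::comm_ring_1 poly \<Rightarrow> nat \<Rightarrow> 'a poly" where
  "shift p e = pcompose p [:of_nat e, 1:]"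

lemma poly_shift: "poly (shift p e) x = poly p (of_nat e + x)"
  by (simp add: shift_def poly_pcompose)

lemma shift_pCons: "shift (pCons c p) e = [:c:] + smult (of_nat e) (shift p e) + pCons 0 (shift p e)"
  by (simp add: shift_def pcompose_pCons)

lemma coeff_shift_in_subgroup:
  assumes "additive_subgroup H" "\<And>i. coeff p i \<in> H"
  shows "coeff (shift p e) i \<in> H"
  using assms(2)
proof (induction p arbitrary: i)
  case 0
  then show ?case using assms(1) by (simp add: shift_def additive_subgroup_def)
next
  case (pCons c p)
  have c: "c \<in> H" using pCons.prems[of 0] by simp
  have p: "coeff (shift p e) i \<in> H" for i
    using pCons.IH pCons.prems by (metis coeff_pCons_Suc)
  have z: "0 \<in> H" and add: "\<And>x y. x \<in> H \<Longrightarrow> y \<in> H \<Longrightarrow> x + y \<in> H"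
    using assms(1) by (auto simp: additive_subgroup_def)
  show ?case
    unfolding shift_pCons coeff_add coeff_smult
    by (intro add additive_subgroup_of_nat_mult assms(1) p)
      (auto simp: coeff_pCons c z p split: nat.split)
qed

text \<open>Shifting the argument by a constant leaves the leading term alone, over any commutative ring. This
is what makes the weight below drop when the polynomials are differenced.\<close>

lemma coeff_shift_top: "degree p \<le> n \<Longrightarrow> coeff (shift p e) n = coeff p n"
proof (induction p arbitrary: n)
  case 0
  then show ?case by (simp add: shift_def)
next
  case (pCons c p)
  show ?case
  proof (cases "p = 0")
    case True
    then show ?thesis by (simp add: shift_pCons shift_def)
  next
    case False
    with pCons.prems obtain m where m: "n = Suc m" "degree p \<le> m"
      by (cases n) auto
    then have "coeff (shift p e) (Suc m) = 0"
      using pCons.IH[of "Suc m"] by (simp add: coeff_eq_0)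
    then show ?thesis using m pCons.IH[of m] by (simp add: shift_pCons)
  qed
qed

text \<open>The weight of a finite set of polynomials is the multiset in which the degree \<open>e\<close> occurs as often
as there are leading coefficients among its nonzero members of degree \<open>e\<close>. Under the multiset order
this is the well-order of PET (polynomial exhaustion) induction: a change in degree \<open>e\<close>
outweighs any change in smaller degrees.\<close>

definition leads :: "'a::comm_ring_1 poly set \<Rightarrow> (nat \<times> 'a) set" where
  "leads A = (\<lambda>p. (degree p, lead_coeff p)) ` (A - {0})"

definition PET_weight :: "'a::comm_ring_1 poly set \<Rightarrow> nat multiset" where
  "PET_weight A = image_mset fst (mset_set (leads A))"

lemma count_PET_weight:
  "finite A \<Longrightarrow> count (PET_weight A) e = card {x \<in> leads A. fst x = e}"
  by (auto simp: PET_weight_def count_image_mset' leads_def intro!: arg_cong[where f = card])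

text \<open>The polynomials \<open>p (d + e) - p e - p1 d\<close> in the variable \<open>d\<close>. They are the displacements from
\<open>x + p e\<close> to \<open>(x - p1 d) + p (d + e)\<close>, that is, what changes when the base point \<open>x\<close> is replaced by
\<open>x - p1 d\<close> and the step \<open>e\<close> by \<open>d + e\<close>.\<close>

definition differenced :: "'a::comm_ring_1 poly set \<Rightarrow> 'a poly \<Rightarrow> nat \<Rightarrow> 'a poly set" where
  "differenced A p1 M = (\<lambda>(p, e). shift p e - [:poly p (of_nat e):] - p1) ` (A \<times> {0..M})"

text \<open>Subtracting \<open>p1\<close> does not touch leading terms of higher degree. In the degree of \<open>p1\<close> all leading
coefficients are translated by that of \<open>p1\<close>, and the one equal to it disappears, so this degree
loses an occurrence. The polynomials with the leading term of \<open>p1\<close> drop to smaller degrees, which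
weigh less. As no polynomial has smaller degree than \<open>p1\<close>, nothing else acquires that degree.\<close>

lemma PET_weight_differenced:
  assumes fin: "finite A" and A0: "0 \<notin> A" and const: "\<And>p. p \<in> A \<Longrightarrow> coeff p 0 = 0"
    and p1: "p1 \<in> A" and min: "\<And>p. p \<in> A \<Longrightarrow> degree p1 \<le> degree p"
  shows "PET_weight (differenced A p1 M) < PET_weight A"
proof -
  define B where "B = differenced A p1 M"
  define m where "m = degree p1"
  have finB: "finite B" using fin by (simp add: B_def differenced_def)
  have finl: "finite (leads A)" using fin by (simp add: leads_def)
  have deg_pos: "degree p \<ge> 1" if "p \<in> A" for p
  proof (rule ccontr)
    assume "\<not> degree p \<ge> 1"
    then have "degree p = 0" by simp
    then obtain c where "p = [:c:]" by (metis degree_eq_zeroE)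
    with const[OF that] A0 that show False by simp
  qed
  have *: "(degree q > m \<longrightarrow> (degree q, lead_coeff q) \<in> leads A) \<and>
      (degree q = m \<longrightarrow> lead_coeff q + lead_coeff p1 \<noteq> lead_coeff p1 \<and>
         (m, lead_coeff q + lead_coeff p1) \<in> leads A)" if q: "q \<in> B" "q \<noteq> 0" for q
  proof -
    obtain p e where p: "p \<in> A" and qe: "q = shift p e - [:poly p (of_nat e):] - p1"
      using q(1) by (auto simp: B_def differenced_def)
    have cq: "coeff q n = coeff p n - coeff p1 n" if "n \<ge> degree p" for n
      using that deg_pos[OF p] by (cases n) (simp_all add: qe coeff_shift_top)
    have degq: "degree q \<le> degree p"
      by (rule degree_le) (use min[OF p] in \<open>auto simp: cq coeff_eq_0\<close>)
    have pl: "(degree p, lead_coeff p) \<in> leads A" using p A0 by (auto simp: leads_def)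
    show ?thesis
    proof (cases "degree p = m")
      case True
      show ?thesis
      proof (intro conjI impI)
        assume "degree q = m"
        then have eq: "lead_coeff q + lead_coeff p1 = lead_coeff p"
          using cq[of m] True by (simp add: m_def)
        show "(m, lead_coeff q + lead_coeff p1) \<in> leads A"
          using pl unfolding eq True .
        have "lead_coeff q \<noteq> 0" using q(2) by simp
        then show "lead_coeff q + lead_coeff p1 \<noteq> lead_coeff p1" by simp
      qed (use True degq in simp)
    next
      case False
      then have gt: "degree p > m" using min[OF p] by (simp add: m_def)
      then have "coeff q (degree p) = lead_coeff p"
        by (simp add: cq coeff_eq_0 m_def)
      moreover have "lead_coeff p \<noteq> 0" using p A0 by auto
      ultimately have "degree q = degree p"
        using degq by (metis le_antisym le_degree)
      then show ?thesis using gt pl \<open>coeff q (degree p) = lead_coeff p\<close> by auto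
    qed
  qed
  have le: "count (PET_weight B) e \<le> count (PET_weight A) e" if "e > m" for e
    unfolding count_PET_weight[OF fin] count_PET_weight[OF finB]
    by (rule card_mono) (use finl * that in \<open>auto simp: leads_def[of B]\<close>)
  have lt: "count (PET_weight B) m < count (PET_weight A) m"
  proof -
    have mem: "(m, lead_coeff p1) \<in> {x \<in> leads A. fst x = m}"
      using p1 A0 by (auto simp: leads_def m_def)
    have "{x \<in> leads B. fst x = m} \<subseteq>
        (\<lambda>(e, c). (e, c - lead_coeff p1)) ` ({x \<in> leads A. fst x = m} - {(m, lead_coeff p1)})"
    proof
      fix x assume "x \<in> {x \<in> leads B. fst x = m}"
      then have x: "x \<in> leads B" "fst x = m" by simp_all
      from x(1) obtain q where "x = (degree q, lead_coeff q)" "q \<in> B - {0}"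
        unfolding leads_def by (rule imageE)
      then have "q \<in> B" "q \<noteq> 0" "degree q = m" "x = (m, lead_coeff q)" using x(2) by simp_all
      with *[of q] show "x \<in> (\<lambda>(e, c). (e, c - lead_coeff p1)) `
          ({x \<in> leads A. fst x = m} - {(m, lead_coeff p1)})"
        by (intro image_eqI[of _ _ "(m, lead_coeff q + lead_coeff p1)"]) auto
    qed
    then have "card {x \<in> leads B. fst x = m} \<le> card ({x \<in> leads A. fst x = m} - {(m, lead_coeff p1)})"
      by (rule surj_card_le[rotated]) (use finl in simp)
    also have "\<dots> < card {x \<in> leads A. fst x = m}"
      using mem finl by (intro card_Diff1_less) auto
    finally show ?thesis
      unfolding count_PET_weight[OF fin] count_PET_weight[OF finB] .
  qed
  have "PET_weight B < PET_weight A"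
    unfolding less_multiset\<^sub>H\<^sub>O
  proof (intro conjI allI impI)
    show "PET_weight B \<noteq> PET_weight A" using lt by auto
    fix y assume "count (PET_weight A) y < count (PET_weight B) y"
    then have "y < m" using le[of y] lt by (metis leD linorder_neqE_nat order.asym)
    then show "\<exists>x>y. count (PET_weight B) x < count (PET_weight A) x" using lt by blast
  qed
  then show ?thesis by (simp add: B_def)
qed

text \<open>The set \<open>F\<close> confines the whole configuration, so that only the colours on \<open>F\<close> matter. Requiring
\<open>F \<subseteq> H\<close> for a subgroup \<open>H\<close> containing the coefficients keeps control over the base points,
which arise as integer combinations of coefficients.\<close>

definition recurrent :: "'a::comm_ring_1 poly set \<Rightarrow> 'a set \<Rightarrow> bool" where
  "recurrent A H \<longleftrightarrow> (\<forall>r. \<exists>F K. finite F \<and> F \<subseteq> H \<and>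
     (\<forall>(\<kappa>::'a \<Rightarrow> nat) \<Gamma>. finite \<Gamma> \<and> card \<Gamma> \<le> r \<and> \<kappa> ` F \<subseteq> \<Gamma> \<longrightarrow>
       (\<exists>x\<in>F. \<exists>d\<in>{1..K}. \<forall>p\<in>A. x + poly p (of_nat d) \<in> F \<and>
          \<kappa> (x + poly p (of_nat d)) = \<kappa> x)))"

lemma recurrent_remove_zero: "recurrent (A - {0}) H \<longleftrightarrow> recurrent A H"
proof -
  have "(\<forall>p\<in>A - {0}. x + poly p (of_nat d) \<in> F \<and> \<kappa> (x + poly p (of_nat d)) = \<kappa> x) \<longleftrightarrow>
      (\<forall>p\<in>A. x + poly p (of_nat d) \<in> F \<and> \<kappa> (x + poly p (of_nat d)) = \<kappa> x)"
    if "x \<in> F" for F x d and \<kappa> :: "'a \<Rightarrow> nat"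
  proof (intro iffI ballI)
    fix p
    assume "\<forall>p\<in>A - {0}. x + poly p (of_nat d) \<in> F \<and> \<kappa> (x + poly p (of_nat d)) = \<kappa> x" "p \<in> A"
    then show "x + poly p (of_nat d) \<in> F \<and> \<kappa> (x + poly p (of_nat d)) = \<kappa> x"
      using that by (cases "p = 0") auto
  qed auto
  then show ?thesis unfolding recurrent_def by (simp cong: bex_cong)
qed

text \<open>The colours in \<open>\<Delta>\<close> are focused at \<open>x\<close>: for each of them there is a step \<open>d\<close> such
that every \<open>x + p d\<close> has this colour. If the colour of \<open>x\<close> belongs to \<open>\<Delta>\<close>, then \<open>x\<close> is the
base point of a monochromatic configuration.\<close>

definition focused ::
  "'a::comm_ring_1 poly set \<Rightarrow> 'a set \<Rightarrow> nat \<Rightarrow> ('a \<Rightarrow> nat) \<Rightarrow> 'a \<Rightarrow> nat set \<Rightarrow> bool" where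
  "focused A F K \<kappa> x \<Delta> \<longleftrightarrow> x \<in> F \<and>
     (\<forall>\<gamma>\<in>\<Delta>. \<exists>d\<in>{1..K}. \<forall>p\<in>A. x + poly p (of_nat d) \<in> F \<and> \<kappa> (x + poly p (of_nat d)) = \<gamma>)"

text \<open>Colour focusing. Suppose that every colouring without a monochromatic configuration focuses
\<open>k\<close> colours inside a finite set \<open>F1\<close>. Colour
each point by the pattern of colours on its translate of \<open>F1\<close>, and find a base point \<open>y\<close> and a step
\<open>d\<close> for the differenced polynomials and this finer colouring. If the patterns seen at \<open>y\<close> focus \<open>k\<close>
colours at \<open>y + x\<close> with steps \<open>e\<close>, then the point \<open>y + x - p1 d\<close> focuses them with steps
\<open>d + e\<close>, and with step \<open>d\<close> it also focuses the colour of \<open>y + x\<close>. Thus the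
number of focused colours grows until all colours are used up.\<close>

lemma recurrent_step:
  fixes A :: "'a::comm_ring_1 poly set"
  assumes H: "additive_subgroup H" and coeffs: "\<And>p i. p \<in> A \<Longrightarrow> coeff p i \<in> H"
    and p1: "p1 \<in> A" and const: "\<And>p. p \<in> A \<Longrightarrow> coeff p 0 = 0"
    and rec: "\<And>M. recurrent (differenced A p1 M) H"
  shows "recurrent A H"
  unfolding recurrent_def
proof
  fix r
  have focus: "\<exists>F K. finite F \<and> F \<subseteq> H \<and> (\<forall>(\<kappa>::'a \<Rightarrow> nat) \<Gamma>. finite \<Gamma> \<and> card \<Gamma> \<le> r \<and> \<kappa> ` F \<subseteq> \<Gamma> \<longrightarrow>
      (\<exists>x. focused A F K \<kappa> x {\<kappa> x}) \<or>
      (\<exists>x \<Delta>. \<Delta> \<subseteq> \<Gamma> \<and> card \<Delta> = k \<and> focused A F K \<kappa> x \<Delta>))" for k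
  proof (induction k)
    case 0
    show ?case
      by (rule exI[of _ "{0}"], rule exI[of _ 1])
        (use H in \<open>auto simp: additive_subgroup_def focused_def\<close>)
  next
    case (Suc k)
    then obtain F1 K1 where F1: "finite F1" "F1 \<subseteq> H" and
      foc': "\<forall>(\<kappa>::'a \<Rightarrow> nat) \<Gamma>. finite \<Gamma> \<and> card \<Gamma> \<le> r \<and> \<kappa> ` F1 \<subseteq> \<Gamma> \<longrightarrow>
      (\<exists>x. focused A F1 K1 \<kappa> x {\<kappa> x}) \<or>
      (\<exists>x \<Delta>. \<Delta> \<subseteq> \<Gamma> \<and> card \<Delta> = k \<and> focused A F1 K1 \<kappa> x \<Delta>)"
      by (elim exE conjE) (rule that, assumption+)
    note foc = foc'[rule_format, OF conjI[OF _ conjI]]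
    obtain fs where fs: "set fs = F1" using F1(1) finite_list by blast
    obtain F2 K2 where F2: "finite F2" "F2 \<subseteq> H" and
      sol': "\<forall>(\<kappa>::'a \<Rightarrow> nat) \<Gamma>. finite \<Gamma> \<and> card \<Gamma> \<le> r ^ length fs \<and> \<kappa> ` F2 \<subseteq> \<Gamma> \<longrightarrow>
       (\<exists>x\<in>F2. \<exists>d\<in>{1..K2}. \<forall>p\<in>differenced A p1 K1. x + poly p (of_nat d) \<in> F2 \<and>
          \<kappa> (x + poly p (of_nat d)) = \<kappa> x)"
      using rec[of K1, unfolded recurrent_def, rule_format, of "r ^ length fs"]
      by (elim exE conjE) (rule that, assumption+)
    note sol = sol'[rule_format, OF conjI[OF _ conjI]]
    define S where "S = (\<lambda>(y, x). y + x) ` (F2 \<times> F1)"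
    define F where "F = S \<union> (\<lambda>(z, d). z - poly p1 (of_nat d)) ` (S \<times> {1..K2})"
    define K where "K = K1 + K2"
    have S_H: "S \<subseteq> H" using F1 F2 H by (auto simp: S_def additive_subgroup_def)
    have finF: "finite F" using F1 F2 by (auto simp: F_def S_def)
    have FH: "F \<subseteq> H"
      using S_H poly_of_nat_in_subgroup[OF H coeffs[OF p1]] additive_subgroup_diff[OF H]
      by (auto simp: F_def)
    have SF: "y + x \<in> F" if "y \<in> F2" "x \<in> F1" for y x
      using that unfolding F_def S_def by blast
    have "(\<exists>x. focused A F K \<kappa> x {\<kappa> x}) \<or>
      (\<exists>x \<Delta>. \<Delta> \<subseteq> \<Gamma> \<and> card \<Delta> = Suc k \<and> focused A F K \<kappa> x \<Delta>)"
      if \<Gamma>: "finite \<Gamma>" "card \<Gamma> \<le> r" "\<kappa> ` F \<subseteq> \<Gamma>" for \<kappa> :: "'a \<Rightarrow> nat" and \<Gamma>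
    proof -
      \<comment> \<open>The colour pattern on the translate of \<open>F1\<close> to \<open>y\<close>, encoded as a single colour.\<close>
      define \<psi> where "\<psi> y = to_nat (map (\<lambda>x. \<kappa> (y + x)) fs)" for y
      define \<Gamma>' where "\<Gamma>' = to_nat ` {xs. set xs \<subseteq> \<Gamma> \<and> length xs = length fs}"
      have "card \<Gamma>' \<le> card \<Gamma> ^ length fs"
        unfolding \<Gamma>'_def card_lists_length_eq[OF \<Gamma>(1), symmetric]
        by (rule card_image_le[OF finite_lists_length_eq[OF \<Gamma>(1)]])
      also have "\<dots> \<le> r ^ length fs" using \<Gamma>(2) by (rule power_mono) simp
      finally have card': "card \<Gamma>' \<le> r ^ length fs" .
      have fin': "finite \<Gamma>'" unfolding \<Gamma>'_def by (rule finite_imageI[OF finite_lists_length_eq[OF \<Gamma>(1)]])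
      have "\<psi> ` F2 \<subseteq> \<Gamma>'"
      proof
        fix z assume "z \<in> \<psi> ` F2"
        then obtain y where y: "y \<in> F2" "z = \<psi> y" by blast
        have "\<kappa> (y + x) \<in> \<Gamma>" if "x \<in> set fs" for x
          using \<Gamma>(3) SF[OF y(1)] that fs by blast
        then show "z \<in> \<Gamma>'" unfolding y(2) \<psi>_def \<Gamma>'_def by (intro imageI) auto
      qed
      from sol[OF fin' card' this] obtain y d where y: "y \<in> F2" and d: "d \<in> {1..K2}"
        and yd: "\<And>p. p \<in> differenced A p1 K1 \<Longrightarrow>
          y + poly p (of_nat d) \<in> F2 \<and> \<psi> (y + poly p (of_nat d)) = \<psi> y" by blast
      have same: "\<kappa> (y + poly p (of_nat d) + x) = \<kappa> (y + x)"
        if "p \<in> differenced A p1 K1" "x \<in> F1" for p x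
        using yd[OF that(1)] that(2) fs by (auto simp: \<psi>_def)
      \<comment> \<open>A pattern that is constant along the differenced polynomials moves each point \<open>x + p e\<close> to \<open>x - p1 d + p (d + e)\<close> without changing its colour.\<close>
      have move: "y + x - poly p1 (of_nat d) + poly p (of_nat (d + e)) \<in> F \<and>
          \<kappa> (y + x - poly p1 (of_nat d) + poly p (of_nat (d + e))) = \<kappa> (y + (x + poly p (of_nat e)))"
        if "p \<in> A" "e \<le> K1" "x + poly p (of_nat e) \<in> F1" for p e x
      proof -
        define q where "q = shift p e - [:poly p (of_nat e):] - p1"
        have q: "q \<in> differenced A p1 K1"
          using that by (force simp: q_def differenced_def)
        have eq: "y + x - poly p1 (of_nat d) + poly p (of_nat (d + e)) =
            (y + poly q (of_nat d)) + (x + poly p (of_nat e))"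
          by (simp add: q_def poly_shift algebra_simps)
        have "(y + poly q (of_nat d)) + (x + poly p (of_nat e)) \<in> F"
          by (rule SF) (use yd[OF q] that(3) in auto)
        then show ?thesis unfolding eq using same[OF q that(3)] by simp
      qed
      have up: "focused A F K \<kappa> (y + x) \<Delta>" if f: "focused A F1 K1 (\<lambda>z. \<kappa> (y + z)) x \<Delta>" for x \<Delta>
        unfolding focused_def K_def
      proof (intro conjI ballI)
        show "y + x \<in> F" using f SF[OF y] by (simp add: focused_def)
        fix \<gamma> assume "\<gamma> \<in> \<Delta>"
        then obtain e where e: "e \<in> {1..K1}"
          "\<And>p. p \<in> A \<Longrightarrow> x + poly p (of_nat e) \<in> F1 \<and> \<kappa> (y + (x + poly p (of_nat e))) = \<gamma>"
          using f unfolding focused_def by blast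
        have "y + x + poly p (of_nat e) \<in> F \<and> \<kappa> (y + x + poly p (of_nat e)) = \<gamma>" if "p \<in> A" for p
          using e(2)[OF that] SF[OF y] by (simp add: add.assoc)
        moreover have "e \<in> {1..K1 + K2}" using e(1) by simp
        ultimately show "\<exists>d\<in>{1..K1 + K2}. \<forall>p\<in>A. y + x + poly p (of_nat d) \<in> F \<and>
            \<kappa> (y + x + poly p (of_nat d)) = \<gamma>" by blast
      qed
      have "(\<lambda>z. \<kappa> (y + z)) ` F1 \<subseteq> \<Gamma>" using \<Gamma>(3) SF y by blast
      from foc[OF \<Gamma>(1,2) this] show ?thesis
      proof (elim disjE exE conjE)
        fix x assume "focused A F1 K1 (\<lambda>z. \<kappa> (y + z)) x {\<kappa> (y + x)}"
        then show ?thesis using up by blast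
      next
        fix x \<Delta>
        assume \<Delta>: "\<Delta> \<subseteq> \<Gamma>" "card \<Delta> = k" and f: "focused A F1 K1 (\<lambda>z. \<kappa> (y + z)) x \<Delta>"
        have x: "x \<in> F1" using f by (simp add: focused_def)
        show ?thesis
        proof (cases "\<kappa> (y + x) \<in> \<Delta>")
          case True
          then have "focused A F K \<kappa> (y + x) {\<kappa> (y + x)}"
            using up[OF f] unfolding focused_def by blast
          then show ?thesis by blast
        next
          case False
          define x' where "x' = y + x - poly p1 (of_nat d)"
          have "\<exists>d'\<in>{1..K}. \<forall>p\<in>A. x' + poly p (of_nat d') \<in> F \<and> \<kappa> (x' + poly p (of_nat d')) = \<gamma>"
            if "\<gamma> \<in> insert (\<kappa> (y + x)) \<Delta>" for \<gamma>
          proof (cases "\<gamma> \<in> \<Delta>")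
            case True
            then obtain e where e: "e \<in> {1..K1}"
              "\<And>p. p \<in> A \<Longrightarrow> x + poly p (of_nat e) \<in> F1 \<and> \<kappa> (y + (x + poly p (of_nat e))) = \<gamma>"
              using f unfolding focused_def by blast
            have "x' + poly p (of_nat (d + e)) \<in> F \<and> \<kappa> (x' + poly p (of_nat (d + e))) = \<gamma>"
              if "p \<in> A" for p
              using move[OF that, of e x] e(1) e(2)[OF that] unfolding x'_def by simp
            moreover have "d + e \<in> {1..K}" using e(1) d by (simp add: K_def)
            ultimately show ?thesis by blast
          next
            case False
            then have \<gamma>: "\<gamma> = \<kappa> (y + x)" using that by simp
            have "x' + poly p (of_nat d) \<in> F \<and> \<kappa> (x' + poly p (of_nat d)) = \<gamma>"
              if "p \<in> A" for p
            proof -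
              have "poly p (of_nat 0) = 0"
                using const[OF that] by (simp add: poly_0_coeff_0)
              then show ?thesis using move[OF that, of 0 x] x unfolding x'_def \<gamma> by simp
            qed
            moreover have "d \<in> {1..K}" using d by (simp add: K_def)
            ultimately show ?thesis by blast
          qed
          moreover have "x' \<in> F" using y x d by (auto simp: x'_def F_def S_def)
          ultimately have "focused A F K \<kappa> x' (insert (\<kappa> (y + x)) \<Delta>)"
            by (simp add: focused_def)
          moreover have "insert (\<kappa> (y + x)) \<Delta> \<subseteq> \<Gamma>" using \<Delta> \<Gamma>(3) SF[OF y x] by blast
          moreover have "card (insert (\<kappa> (y + x)) \<Delta>) = Suc k"
            using False \<Delta> \<Gamma>(1) finite_subset by (metis card_insert_disjoint)
          ultimately show ?thesis by blast
        qed
      qed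
    qed
    then have main: "\<forall>(\<kappa>::'a \<Rightarrow> nat) \<Gamma>. finite \<Gamma> \<and> card \<Gamma> \<le> r \<and> \<kappa> ` F \<subseteq> \<Gamma> \<longrightarrow>
      (\<exists>x. focused A F K \<kappa> x {\<kappa> x}) \<or>
      (\<exists>x \<Delta>. \<Delta> \<subseteq> \<Gamma> \<and> card \<Delta> = Suc k \<and> focused A F K \<kappa> x \<Delta>)"
      by simp
    show ?case
      by (rule exI[of _ F], rule exI[of _ K]) (intro conjI finF FH main)
  qed
  from focus[of r] obtain F K where F: "finite F" "F \<subseteq> H" and
    foc': "\<forall>(\<kappa>::'a \<Rightarrow> nat) \<Gamma>. finite \<Gamma> \<and> card \<Gamma> \<le> r \<and> \<kappa> ` F \<subseteq> \<Gamma> \<longrightarrow>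
      (\<exists>x. focused A F K \<kappa> x {\<kappa> x}) \<or>
      (\<exists>x \<Delta>. \<Delta> \<subseteq> \<Gamma> \<and> card \<Delta> = r \<and> focused A F K \<kappa> x \<Delta>)"
    by (elim exE conjE) (rule that, assumption+)
  note foc = foc'[rule_format, OF conjI[OF _ conjI]]
  have sol: "\<exists>x\<in>F. \<exists>d\<in>{1..K}. \<forall>p\<in>A. x + poly p (of_nat d) \<in> F \<and> \<kappa> (x + poly p (of_nat d)) = \<kappa> x"
    if \<Gamma>: "finite \<Gamma>" "card \<Gamma> \<le> r" "\<kappa> ` F \<subseteq> \<Gamma>" for \<kappa> :: "'a \<Rightarrow> nat" and \<Gamma>
  proof -
    have "\<exists>x. focused A F K \<kappa> x {\<kappa> x}"
      using foc[OF \<Gamma>]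
    proof (elim disjE exE conjE)
      fix x \<Delta> assume \<Delta>: "\<Delta> \<subseteq> \<Gamma>" "card \<Delta> = r" and f: "focused A F K \<kappa> x \<Delta>"
      have "\<Delta> = \<Gamma>" using \<Delta> \<Gamma> by (metis card_seteq)
      then have "\<kappa> x \<in> \<Delta>" using f \<Gamma>(3) by (auto simp: focused_def)
      then show ?thesis using f unfolding focused_def by blast
    qed auto
    then show ?thesis unfolding focused_def by blast
  qed
  show "\<exists>F K. finite F \<and> F \<subseteq> H \<and>
     (\<forall>(\<kappa>::'a \<Rightarrow> nat) \<Gamma>. finite \<Gamma> \<and> card \<Gamma> \<le> r \<and> \<kappa> ` F \<subseteq> \<Gamma> \<longrightarrow>
       (\<exists>x\<in>F. \<exists>d\<in>{1..K}. \<forall>p\<in>A. x + poly p (of_nat d) \<in> F \<and>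
          \<kappa> (x + poly p (of_nat d)) = \<kappa> x))"
    by (intro exI[of _ F] exI[of _ K] conjI F allI impI) (elim conjE, rule sol, assumption+)
qed

text \<open>The zero polynomial is discarded before each step: it would contribute \<open>- p1\<close> to the differenced
set and so could spoil the decrease of the weight.\<close>

theorem polynomial_van_der_Waerden:
  fixes A :: "'a::comm_ring_1 poly set"
  assumes H: "additive_subgroup H" and "finite A"
    and "\<And>p. p \<in> A \<Longrightarrow> coeff p 0 = 0" and "\<And>p i. p \<in> A \<Longrightarrow> coeff p i \<in> H"
  shows "recurrent A H"
  using assms(2-)
proof (induction "PET_weight A" arbitrary: A rule: less_induct)
  case less
  define A' where "A' = A - {0}"
  have "recurrent A' H"
  proof (cases "A' = {}")
    case True
    have "0 \<in> H" using H by (simp add: additive_subgroup_def)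
    then show ?thesis
      unfolding recurrent_def True
      by (intro allI exI[of _ "{0}"] exI[of _ 1]) auto
  next
    case False
    then obtain p0 where "p0 \<in> A'" by blast
    from ex_has_least_nat[of "\<lambda>p. p \<in> A'", OF this, of degree]
    obtain p1 where p1: "p1 \<in> A'" and min: "\<And>p. p \<in> A' \<Longrightarrow> degree p1 \<le> degree p"
      by blast
    have w: "PET_weight A' = PET_weight A" by (simp add: A'_def PET_weight_def leads_def)
    have rec: "recurrent (differenced A' p1 M) H" for M
    proof (rule less.hyps)
      show "PET_weight (differenced A' p1 M) < PET_weight A"
        unfolding w[symmetric] by (rule PET_weight_differenced) (use less.prems p1 min in \<open>auto simp: A'_def\<close>)
      show "finite (differenced A' p1 M)"
        using less.prems by (simp add: A'_def differenced_def)
      show "coeff q 0 = 0" if q: "q \<in> differenced A' p1 M" for q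
      proof -
        obtain p e where "p \<in> A'" "q = shift p e - [:poly p (of_nat e):] - p1"
          using q by (auto simp: differenced_def)
        moreover have "poly p1 0 = 0"
          using less.prems(2) p1 by (simp add: A'_def poly_0_coeff_0)
        ultimately have "poly q 0 = 0" by (simp add: poly_shift)
        then show ?thesis by (simp add: poly_0_coeff_0)
      qed
      show "coeff q i \<in> H" if q: "q \<in> differenced A' p1 M" for q i
      proof -
        obtain p e where p: "p \<in> A'" "q = shift p e - [:poly p (of_nat e):] - p1"
          using q by (auto simp: differenced_def)
        have cp: "\<And>i. coeff p i \<in> H" "\<And>i. coeff p1 i \<in> H" using p(1) p1 less.prems(3) by (auto simp: A'_def)
        have "coeff [:poly p (of_nat e):] i \<in> H"
          using poly_of_nat_in_subgroup[OF H cp(1)] H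
          by (simp add: coeff_pCons additive_subgroup_def split: nat.split)
        then show ?thesis
          unfolding p(2) coeff_diff
          by (intro additive_subgroup_diff[OF H] coeff_shift_in_subgroup H cp)
      qed
    qed
    show ?thesis
      by (rule recurrent_step[OF H _ p1 _ rec]) (use less.prems in \<open>auto simp: A'_def\<close>)
  qed
  then show ?case
    by (simp add: recurrent_remove_zero A'_def)
qed

section \<open>Polynomial functions of a weighted parameter vector\<close>

text \<open>Coordinates of parameter vectors are labelled by lists of numbers: prefixing the label with \<open>q\<close>
gives the \<open>q\<close>-th of several disjoint copies of a set of labels.\<close>

abbreviation dilate :: "nat \<Rightarrow> (nat list \<Rightarrow> int) \<Rightarrow> nat list \<Rightarrow> int" where
  "dilate d g \<equiv> (\<lambda>l. int d * g l)"

text \<open>Stands in for homogeneous polynomials of degree \<open>e\<close> in the coordinates from \<open>L\<close>, keeping the three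
properties that matter: dependence on \<open>L\<close> only, scaling, and size \<open>O(B ^ k)\<close> when each \<open>g l\<close> is
\<open>O(B ^ \<omega> l)\<close>.\<close>

definition weighted_homogeneous ::
  "nat list set \<Rightarrow> (nat list \<Rightarrow> nat) \<Rightarrow> nat \<Rightarrow> nat \<Rightarrow> ((nat list \<Rightarrow> int) \<Rightarrow> int) \<Rightarrow> bool" where
  "weighted_homogeneous L \<omega> k e f \<longleftrightarrow>
     (\<forall>g g'. (\<forall>l\<in>L. g l = g' l) \<longrightarrow> f g = f g') \<and>
     (\<forall>d g. f (dilate d g) = int d ^ e * f g) \<and>
     (\<forall>c. \<exists>C. \<forall>B\<ge>1. \<forall>g. (\<forall>l\<in>L. \<bar>g l\<bar> \<le> c * B ^ \<omega> l) \<longrightarrow> \<bar>f g\<bar> \<le> C * B ^ k)"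

lemma weighted_homogeneous_bound:
  "weighted_homogeneous L \<omega> k e f \<Longrightarrow> \<exists>C. \<forall>B\<ge>1. \<forall>g. (\<forall>l\<in>L. \<bar>g l\<bar> \<le> c * B ^ \<omega> l) \<longrightarrow> \<bar>f g\<bar> \<le> C * B ^ k"
  unfolding weighted_homogeneous_def by blast

lemma weighted_homogeneous_dilate: "weighted_homogeneous L \<omega> k e f \<Longrightarrow> f (dilate d g) = int d ^ e * f g"
  unfolding weighted_homogeneous_def by blast

text \<open>Sums of homogeneous functions of positive degree, that is, without constant term. Positivity of the
degrees is used twice: the polynomial van der Waerden theorem needs it, and it gives divisibility
under dilation.\<close>

inductive weighted_poly ::
  "nat list set \<Rightarrow> (nat list \<Rightarrow> nat) \<Rightarrow> nat \<Rightarrow> ((nat list \<Rightarrow> int) \<Rightarrow> int) \<Rightarrow> bool"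
  for L \<omega> k where
  zero: "weighted_poly L \<omega> k (\<lambda>g. 0)"
| hom: "weighted_homogeneous L \<omega> k e f \<Longrightarrow> e \<ge> 1 \<Longrightarrow> weighted_poly L \<omega> k f"
| add: "weighted_poly L \<omega> k f \<Longrightarrow> weighted_poly L \<omega> k f' \<Longrightarrow> weighted_poly L \<omega> k (\<lambda>g. f g + f' g)"

lemma weighted_poly_cong:
  "weighted_poly L \<omega> k f \<Longrightarrow> (\<And>l. l \<in> L \<Longrightarrow> g l = g' l) \<Longrightarrow> f g = f g'"
  by (induction rule: weighted_poly.induct) (auto simp: weighted_homogeneous_def)

lemma weighted_poly_bound:
  "weighted_poly L \<omega> k f \<Longrightarrow> \<exists>C. \<forall>B\<ge>1. \<forall>g. (\<forall>l\<in>L. \<bar>g l\<bar> \<le> c * B ^ \<omega> l) \<longrightarrow> \<bar>f g\<bar> \<le> C * B ^ k"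
proof (induction rule: weighted_poly.induct)
  case zero
  show ?case by (rule exI[of _ 0]) simp
next
  case (hom e f)
  then show ?case by (intro weighted_homogeneous_bound)
next
  case (add f f')
  then obtain C C' where
    "\<forall>B\<ge>1. \<forall>g. (\<forall>l\<in>L. \<bar>g l\<bar> \<le> c * B ^ \<omega> l) \<longrightarrow> \<bar>f g\<bar> \<le> C * B ^ k"
    "\<forall>B\<ge>1. \<forall>g. (\<forall>l\<in>L. \<bar>g l\<bar> \<le> c * B ^ \<omega> l) \<longrightarrow> \<bar>f' g\<bar> \<le> C' * B ^ k" by blast
  then show ?case
    by (intro exI[of _ "C + C'"]) (auto simp: distrib_right intro!: order_trans[OF abs_triangle_ineq add_mono])
qed

lemma weighted_poly_bound_common:
  assumes "finite \<F>" "\<And>f. f \<in> \<F> \<Longrightarrow> weighted_poly L \<omega> k f"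
  shows "\<exists>C\<ge>1. \<forall>f\<in>\<F>. \<forall>B\<ge>1. \<forall>g. (\<forall>l\<in>L. \<bar>g l\<bar> \<le> c * B ^ \<omega> l) \<longrightarrow> \<bar>f g\<bar> \<le> C * B ^ k"
  using assms
proof (induction \<F> rule: finite_induct)
  case empty
  show ?case by (rule exI[of _ 1]) simp
next
  case (insert f \<F>)
  then obtain C where C: "C \<ge> 1"
    "\<forall>f\<in>\<F>. \<forall>B\<ge>1. \<forall>g. (\<forall>l\<in>L. \<bar>g l\<bar> \<le> c * B ^ \<omega> l) \<longrightarrow> \<bar>f g\<bar> \<le> C * B ^ k" by auto
  obtain C' where C': "\<forall>B\<ge>1. \<forall>g. (\<forall>l\<in>L. \<bar>g l\<bar> \<le> c * B ^ \<omega> l) \<longrightarrow> \<bar>f g\<bar> \<le> C' * B ^ k"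
    using weighted_poly_bound[of L \<omega> k f c] insert.prems by auto
  have mono: "C * B ^ k \<le> max C C' * B ^ k \<and> C' * B ^ k \<le> max C C' * B ^ k" if "B \<ge> 1" for B :: int
    using that by (intro conjI mult_right_mono) auto
  show ?case
  proof (intro exI[of _ "max C C'"] conjI ballI allI impI)
    show "1 \<le> max C C'" using C(1) by simp
    fix f' B g assume *: "f' \<in> insert f \<F>" "(1::int) \<le> B" "\<forall>l\<in>L. \<bar>g l\<bar> \<le> c * B ^ \<omega> l"
    then have "\<bar>f' g\<bar> \<le> C * B ^ k \<or> \<bar>f' g\<bar> \<le> C' * B ^ k" using C(2) C' by blast
    then show "\<bar>f' g\<bar> \<le> max C C' * B ^ k" using mono[OF *(2)] by linarith
  qed
qed

lemma weighted_poly_mono: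
  assumes "weighted_poly L \<omega> k f" "k \<le> k'"
  shows "weighted_poly L \<omega> k' f"
  using assms(1)
proof (induction rule: weighted_poly.induct)
  case (hom e f)
  have "\<exists>C'. \<forall>B\<ge>1. \<forall>g. (\<forall>l\<in>L. \<bar>g l\<bar> \<le> c * B ^ \<omega> l) \<longrightarrow> \<bar>f g\<bar> \<le> C' * B ^ k'" for c
  proof -
    obtain C where C: "\<forall>B\<ge>1. \<forall>g. (\<forall>l\<in>L. \<bar>g l\<bar> \<le> c * B ^ \<omega> l) \<longrightarrow> \<bar>f g\<bar> \<le> C * B ^ k"
      using weighted_homogeneous_bound[OF hom(1)] by blast
    have "C * B ^ k \<le> \<bar>C\<bar> * B ^ k'" if "B \<ge> 1" for B :: int
      using that assms(2) by (intro mult_mono power_increasing) auto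
    then show ?thesis using C by (intro exI[of _ "\<bar>C\<bar>"]) (meson order_trans)
  qed
  then have "weighted_homogeneous L \<omega> k' e f" using hom by (simp add: weighted_homogeneous_def)
  then show ?case using hom.hyps(2) by (rule weighted_poly.hom)
qed (auto intro: weighted_poly.intros)

lemma weighted_poly_cmult:
  assumes "weighted_poly L \<omega> k f"
  shows "weighted_poly L \<omega> k (\<lambda>g. c * f g)"
  using assms
proof (induction rule: weighted_poly.induct)
  case zero
  show ?case using weighted_poly.zero by simp
next
  case (hom e f)
  have "\<exists>C'. \<forall>B\<ge>1. \<forall>g. (\<forall>l\<in>L. \<bar>g l\<bar> \<le> c' * B ^ \<omega> l) \<longrightarrow> \<bar>c * f g\<bar> \<le> C' * B ^ k" for c'
  proof -
    obtain C where C: "\<forall>B\<ge>1. \<forall>g. (\<forall>l\<in>L. \<bar>g l\<bar> \<le> c' * B ^ \<omega> l) \<longrightarrow> \<bar>f g\<bar> \<le> C * B ^ k"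
      using weighted_homogeneous_bound[OF hom(1)] by blast
    then show ?thesis
      by (intro exI[of _ "\<bar>c\<bar> * C"]) (auto simp: abs_mult mult.assoc intro!: mult_left_mono)
  qed
  then have "weighted_homogeneous L \<omega> k e (\<lambda>g. c * f g)" using hom by (simp add: weighted_homogeneous_def)
  then show ?case using hom.hyps(2) by (rule weighted_poly.hom)
next
  case (add f f')
  then show ?case by (simp add: distrib_left weighted_poly.add)
qed

lemma weighted_poly_sum:
  "(\<And>i. i \<in> T \<Longrightarrow> weighted_poly L \<omega> k (f i)) \<Longrightarrow> weighted_poly L \<omega> k (\<lambda>g. \<Sum>i\<in>T. f i g)"
  by (induction T rule: infinite_finite_induct) (auto intro: weighted_poly.intros)

lemma weighted_homogeneous_mult:
  assumes "weighted_homogeneous L \<omega> k e f" "weighted_homogeneous L \<omega> k' e' f'"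
  shows "weighted_homogeneous L \<omega> (k + k') (e + e') (\<lambda>g. f g * f' g)"
proof -
  have "\<exists>D. \<forall>B\<ge>1. \<forall>g. (\<forall>l\<in>L. \<bar>g l\<bar> \<le> c * B ^ \<omega> l) \<longrightarrow> \<bar>f g * f' g\<bar> \<le> D * B ^ (k + k')" for c
  proof -
    obtain C where C: "\<forall>B\<ge>1. \<forall>g. (\<forall>l\<in>L. \<bar>g l\<bar> \<le> c * B ^ \<omega> l) \<longrightarrow> \<bar>f g\<bar> \<le> C * B ^ k"
      using weighted_homogeneous_bound[OF assms(1)] by blast
    obtain C' where C': "\<forall>B\<ge>1. \<forall>g. (\<forall>l\<in>L. \<bar>g l\<bar> \<le> c * B ^ \<omega> l) \<longrightarrow> \<bar>f' g\<bar> \<le> C' * B ^ k'"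
      using weighted_homogeneous_bound[OF assms(2)] by blast
    show ?thesis
    proof (intro exI[of _ "C * C'"] allI impI)
      fix B g assume *: "(1::int) \<le> B" "\<forall>l\<in>L. \<bar>g l\<bar> \<le> c * B ^ \<omega> l"
      have "\<bar>f g\<bar> \<le> C * B ^ k" "\<bar>f' g\<bar> \<le> C' * B ^ k'" using C C' * by blast+
      then have "\<bar>f g\<bar> * \<bar>f' g\<bar> \<le> (C * B ^ k) * (C' * B ^ k')"
        by (intro mult_mono) (auto intro: order_trans[OF abs_ge_zero])
      then show "\<bar>f g * f' g\<bar> \<le> C * C' * B ^ (k + k')"
        by (simp add: abs_mult power_add mult_ac)
    qed
  qed
  moreover have "f g * f' g = f g2 * f' g2" if "\<forall>l\<in>L. g l = g2 l" for g g2
    using assms that unfolding weighted_homogeneous_def by metis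
  moreover have "f (dilate d g) * f' (dilate d g) = int d ^ (e + e') * (f g * f' g)" for d g
    using weighted_homogeneous_dilate[OF assms(1)] weighted_homogeneous_dilate[OF assms(2)] by (simp add: power_add)
  ultimately show ?thesis unfolding weighted_homogeneous_def by blast
qed

lemma weighted_poly_mult:
  assumes "weighted_poly L \<omega> k f" "weighted_poly L \<omega> k' f'"
  shows "weighted_poly L \<omega> (k + k') (\<lambda>g. f g * f' g)"
  using assms(1)
proof (induction rule: weighted_poly.induct)
  case zero
  show ?case using weighted_poly.zero by simp
next
  case (hom e f)
  note f = hom
  show ?case using assms(2)
  proof (induction rule: weighted_poly.induct)
    case zero
    show ?case using weighted_poly.zero by simp
  next
    case (hom e' f')
    show ?case by (rule weighted_poly.hom[OF weighted_homogeneous_mult[OF f(1) hom(1)]]) (use hom(2) in simp)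
  next
    case (add f1 f2)
    then show ?case by (simp add: distrib_left weighted_poly.add)
  qed
next
  case (add f f')
  then show ?case by (simp add: distrib_right weighted_poly.add)
qed

lemma weighted_poly_dilate_divisible:
  assumes "weighted_poly L \<omega> k f"
  shows "\<exists>f'. weighted_poly L \<omega> k f' \<and> (\<forall>g. f (dilate A g) = int A * f' g)"
  using assms
proof (induction rule: weighted_poly.induct)
  case zero
  show ?case using weighted_poly.zero by (intro exI[of _ "\<lambda>g. 0"]) simp
next
  case (hom e f)
  have "f (dilate A g) = int A * (int A ^ (e - 1) * f g)" for g
    using hom by (simp add: weighted_homogeneous_def power_eq_if)
  moreover have "weighted_poly L \<omega> k (\<lambda>g. int A ^ (e - 1) * f g)"
    by (intro weighted_poly_cmult weighted_poly.hom[OF hom])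
  ultimately show ?case by blast
next
  case (add f1 f2)
  then obtain f1' f2' where "weighted_poly L \<omega> k f1'" "weighted_poly L \<omega> k f2'"
    "\<forall>g. f1 (dilate A g) = int A * f1' g" "\<forall>g. f2 (dilate A g) = int A * f2' g" by blast
  then show ?case
    by (intro exI[of _ "\<lambda>g. f1' g + f2' g"]) (simp add: weighted_poly.add distrib_left)
qed

lemma weighted_poly_dilate:
  assumes "weighted_poly L \<omega> k f"
  shows "weighted_poly L \<omega> k (\<lambda>g. f (dilate d g))"
proof -
  obtain f' where f': "weighted_poly L \<omega> k f'" "\<forall>g. f (dilate d g) = int d * f' g"
    using weighted_poly_dilate_divisible[OF assms] by blast
  then show ?thesis using weighted_poly_cmult[OF f'(1), of "int d"] by simp
qed

lemma weighted_poly_relabel: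
  assumes "weighted_poly L \<omega> k f" "\<And>l. l \<in> L \<Longrightarrow> h l \<in> L' \<and> \<omega>' (h l) = \<omega> l"
  shows "weighted_poly L' \<omega>' k (\<lambda>g. f (\<lambda>l. g (h l)))"
  using assms(1)
proof (induction rule: weighted_poly.induct)
  case (hom e f)
  have "\<exists>C. \<forall>B\<ge>1. \<forall>g. (\<forall>l\<in>L'. \<bar>g l\<bar> \<le> c * B ^ \<omega>' l) \<longrightarrow> \<bar>f (\<lambda>l. g (h l))\<bar> \<le> C * B ^ k" for c
  proof -
    obtain C where C: "\<forall>B\<ge>1. \<forall>g. (\<forall>l\<in>L. \<bar>g l\<bar> \<le> c * B ^ \<omega> l) \<longrightarrow> \<bar>f g\<bar> \<le> C * B ^ k"
      using weighted_homogeneous_bound[OF hom(1)] by blast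
    show ?thesis
    proof (intro exI[of _ C] allI impI)
      fix B g assume *: "(1::int) \<le> B" "\<forall>l\<in>L'. \<bar>g l\<bar> \<le> c * B ^ \<omega>' l"
      then have "\<forall>l\<in>L. \<bar>g (h l)\<bar> \<le> c * B ^ \<omega> l" using assms(2) by metis
      then show "\<bar>f (\<lambda>l. g (h l))\<bar> \<le> C * B ^ k"
        using C[rule_format, of B "\<lambda>l. g (h l)"] *(1) by blast
    qed
  qed
  moreover have "f (\<lambda>l. g (h l)) = f (\<lambda>l. g' (h l))" if "\<forall>l\<in>L'. g l = g' l" for g g'
    using hom(1) that assms(2) by (simp add: weighted_homogeneous_def)
  ultimately have "weighted_homogeneous L' \<omega>' k e (\<lambda>g. f (\<lambda>l. g (h l)))"
    using hom by (simp add: weighted_homogeneous_def)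
  then show ?case using hom.hyps(2) by (rule weighted_poly.hom)
qed (auto intro: weighted_poly.intros)

lemma weighted_poly_coordinate: "l \<in> L \<Longrightarrow> \<omega> l = k \<Longrightarrow> weighted_poly L \<omega> k (\<lambda>g. g l)"
  by (rule weighted_poly.hom[of _ _ _ 1]) (auto simp: weighted_homogeneous_def)

lemma weighted_poly_diff: "weighted_poly L \<omega> k f \<Longrightarrow> weighted_poly L \<omega> k f' \<Longrightarrow> weighted_poly L \<omega> k (\<lambda>g. f g - f' g)"
  using weighted_poly.add[OF _ weighted_poly_cmult[of L \<omega> k f' "-1"]] by simp

lemma weighted_poly_additive_subgroup: "additive_subgroup {f. weighted_poly L \<omega> k f}"
  unfolding additive_subgroup_def
proof (intro conjI ballI; unfold mem_Collect_eq)
  show "weighted_poly L \<omega> k 0" using weighted_poly.zero by (simp add: zero_fun_def)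
  show "weighted_poly L \<omega> k (f + f')" if "weighted_poly L \<omega> k f" "weighted_poly L \<omega> k f'" for f f'
    using weighted_poly.add[OF that] by (simp add: plus_fun_def)
  show "weighted_poly L \<omega> k (- f)" if "weighted_poly L \<omega> k f" for f
    using weighted_poly_cmult[OF that, of "-1"] by (simp add: fun_Compl_def)
qed

text \<open>Viewed as a function of the dilation factor, \<open>f (dilate d g)\<close> is a polynomial whose coefficients are
the homogeneous parts of \<open>f\<close>, which are themselves elements of the ring of functions of \<open>g\<close>.\<close>

lemma weighted_poly_dilation_polynomial:
  assumes "weighted_poly L \<omega> k f"
  shows "\<exists>Q. coeff Q 0 = 0 \<and> (\<forall>i. weighted_poly L \<omega> k (coeff Q i)) \<and>
    (\<forall>d. poly Q (of_nat d) = (\<lambda>g. f (dilate d g)))"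
  using assms
proof (induction rule: weighted_poly.induct)
  case zero
  show ?case using weighted_poly.zero by (intro exI[of _ 0]) (simp add: zero_fun_def)
next
  case (hom e f)
  show ?case
  proof (intro exI[of _ "monom f e"] conjI allI)
    show "coeff (monom f e) 0 = 0" using hom(2) by simp
    show "weighted_poly L \<omega> k (coeff (monom f e) i)" for i
      using weighted_poly.hom[OF hom] weighted_poly.zero by (simp add: zero_fun_def)
    show "poly (monom f e) (of_nat d) = (\<lambda>g. f (dilate d g))" for d
    proof
      fix g
      have "(of_nat d ^ e :: (nat list \<Rightarrow> int) \<Rightarrow> int) g = int d ^ e"
        by (induction e) simp_all
      then show "poly (monom f e) (of_nat d) g = f (dilate d g)"
        unfolding poly_monom using weighted_homogeneous_dilate[OF hom(1)] by simp
    qed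
  qed
next
  case (add f f')
  then obtain Q Q' where Q: "coeff Q 0 = 0" "coeff Q' 0 = 0"
    "\<forall>i. weighted_poly L \<omega> k (coeff Q i)" "\<forall>i. weighted_poly L \<omega> k (coeff Q' i)"
    "\<forall>d. poly Q (of_nat d) = (\<lambda>g. f (dilate d g))" "\<forall>d. poly Q' (of_nat d) = (\<lambda>g. f' (dilate d g))"
    by blast
  show ?case
  proof (intro exI[of _ "Q + Q'"] conjI allI)
    show "coeff (Q + Q') 0 = 0" using Q by simp
    show "weighted_poly L \<omega> k (coeff (Q + Q') i)" for i
      using Q by (simp add: plus_fun_def weighted_poly.add)
    show "poly (Q + Q') (of_nat d) = (\<lambda>g. f (dilate d g) + f' (dilate d g))" for d
      by (rule ext) (simp only: poly_add plus_fun_apply Q)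
  qed
qed

text \<open>For each \<open>x\<close>, \<open>g\<close> and \<open>\<kappa>\<close>, colour the ring of functions of the parameter vector by giving \<open>u\<close> the
colour of \<open>x + u g\<close>. Since \<open>\<O>\<close> and \<open>K\<close> come from the ring alone, they serve all \<open>x\<close>, \<open>g\<close>
and \<open>\<kappa>\<close> simultaneously.\<close>

theorem weighted_poly_van_der_Waerden:
  assumes "finite \<F>" "\<forall>f\<in>\<F>. weighted_poly L \<omega> k f"
  shows "\<exists>\<O> K. finite \<O> \<and> (\<forall>u\<in>\<O>. weighted_poly L \<omega> k u) \<and>
    (\<forall>x g (\<kappa>::int \<Rightarrow> nat) \<Gamma>. finite \<Gamma> \<and> card \<Gamma> \<le> r \<and> (\<forall>u\<in>\<O>. \<kappa> (x + u g) \<in> \<Gamma>) \<longrightarrow>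
      (\<exists>u\<in>\<O>. \<exists>d\<in>{1..K}. \<forall>f\<in>\<F>. (\<lambda>g. u g + f (dilate d g)) \<in> \<O> \<and>
         \<kappa> (x + (u g + f (dilate d g))) = \<kappa> (x + u g)))"
proof -
  obtain Q where Q: "\<And>f. f \<in> \<F> \<Longrightarrow> coeff (Q f) 0 = 0 \<and> (\<forall>i. weighted_poly L \<omega> k (coeff (Q f) i)) \<and>
    (\<forall>d. poly (Q f) (of_nat d) = (\<lambda>g. f (dilate d g)))"
    using weighted_poly_dilation_polynomial[OF bspec[OF assms(2)]] by metis
  have "recurrent (Q ` \<F>) {f. weighted_poly L \<omega> k f}"
    by (rule polynomial_van_der_Waerden[OF weighted_poly_additive_subgroup]) (use assms(1) Q in auto)
  from this[unfolded recurrent_def, rule_format, of r] obtain \<O> K where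
    \<O>: "finite \<O>" "\<O> \<subseteq> {f. weighted_poly L \<omega> k f}" and
    rec: "\<forall>(\<kappa>::((nat list \<Rightarrow> int) \<Rightarrow> int) \<Rightarrow> nat) \<Gamma>. finite \<Gamma> \<and> card \<Gamma> \<le> r \<and> \<kappa> ` \<O> \<subseteq> \<Gamma> \<longrightarrow>
       (\<exists>x\<in>\<O>. \<exists>d\<in>{1..K}. \<forall>p\<in>Q ` \<F>. x + poly p (of_nat d) \<in> \<O> \<and>
          \<kappa> (x + poly p (of_nat d)) = \<kappa> x)"
    by (elim exE conjE) (rule that, assumption+)
  have sol: "\<exists>u\<in>\<O>. \<exists>d\<in>{1..K}. \<forall>f\<in>\<F>. (\<lambda>g. u g + f (dilate d g)) \<in> \<O> \<and>
         \<kappa> (x + (u g + f (dilate d g))) = \<kappa> (x + u g)"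
    if "finite \<Gamma>" "card \<Gamma> \<le> r" "\<forall>u\<in>\<O>. \<kappa> (x + u g) \<in> \<Gamma>" for x g \<Gamma> and \<kappa> :: "int \<Rightarrow> nat"
  proof -
    have "(\<lambda>u. \<kappa> (x + u g)) ` \<O> \<subseteq> \<Gamma>" using that(3) by blast
    from rec[rule_format, OF conjI[OF that(1) conjI[OF that(2) this]]]
    obtain u d where ud: "u \<in> \<O>" "d \<in> {1..K}" and
      *: "\<And>f. f \<in> \<F> \<Longrightarrow> u + poly (Q f) (of_nat d) \<in> \<O> \<and>
          \<kappa> (x + (u + poly (Q f) (of_nat d)) g) = \<kappa> (x + u g)" by blast
    have eq: "u + poly (Q f) (of_nat d) = (\<lambda>g. u g + f (dilate d g))" if "f \<in> \<F>" for f
      using Q[OF that] by (simp add: plus_fun_def)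
    have "(\<lambda>g. u g + f (dilate d g)) \<in> \<O> \<and> \<kappa> (x + (u g + f (dilate d g))) = \<kappa> (x + u g)"
      if "f \<in> \<F>" for f
      using *[OF that] unfolding eq[OF that] .
    then show ?thesis using ud by blast
  qed
  have "\<forall>u\<in>\<O>. weighted_poly L \<omega> k u" using \<O>(2) by blast
  then show ?thesis
    by (intro exI[of _ \<O>] exI[of _ K] conjI allI impI \<O>(1)) (assumption, elim conjE, rule sol, assumption+)
qed

section \<open>Ramsey systems\<close>

text \<open>The values of the functions in \<open>\<F>\<close> allow one to recover the coordinates in \<open>J\<close> from the remaining
ones. This is how the fibres of a parametrisation of solutions are bounded without
any counting during the construction.\<close>

definition determines :: "nat list set \<Rightarrow> ((nat list \<Rightarrow> int) \<Rightarrow> int) set \<Rightarrow> bool" where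
  "determines J \<F> \<longleftrightarrow> (\<forall>g g'. (\<forall>l. l \<notin> J \<longrightarrow> g l = g' l) \<and> (\<forall>f\<in>\<F>. f g = f g') \<longrightarrow> g = g')"

lemma determinesD:
  "determines J \<F> \<Longrightarrow> (\<And>l. l \<notin> J \<Longrightarrow> g l = g' l) \<Longrightarrow> (\<And>f. f \<in> \<F> \<Longrightarrow> f g = f g') \<Longrightarrow> g = g'"
  unfolding determines_def by blast

definition copy :: "nat \<Rightarrow> nat \<Rightarrow> ((nat list \<Rightarrow> int) \<Rightarrow> int) \<Rightarrow> (nat list \<Rightarrow> int) \<Rightarrow> int" where
  "copy q D f = (\<lambda>g. f (\<lambda>l. int D * g (q # l)))"

lemma determines_copy_aux:
  assumes "determines J \<F>" "D \<ge> 1" "\<And>l. l \<notin> J \<Longrightarrow> g (q # l) = g' (q # l)"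
    "\<And>f. f \<in> \<F> \<Longrightarrow> copy q D f g = copy q D f g'"
  shows "g (q # l) = g' (q # l)"
proof -
  have "(\<lambda>l. int D * g (q # l)) = (\<lambda>l. int D * g' (q # l))"
  proof (rule determinesD[OF assms(1)])
    show "int D * g (q # l) = int D * g' (q # l)" if "l \<notin> J" for l
      using assms(3)[OF that] by simp
    show "f (\<lambda>l. int D * g (q # l)) = f (\<lambda>l. int D * g' (q # l))" if "f \<in> \<F>" for f
      using assms(4)[OF that] by (simp add: copy_def)
  qed
  from fun_cong[OF this, of l] show ?thesis using assms(2) by simp
qed

lemma determines_copy:
  assumes "determines J \<F>" "D \<ge> 1"
  shows "determines ((#) q ` J) (copy q D ` \<F>)"
  unfolding determines_def
proof (intro allI impI, elim conjE)
  fix g g' assume off: "\<forall>l. l \<notin> (#) q ` J \<longrightarrow> g l = g' l" and eq: "\<forall>f\<in>copy q D ` \<F>. f g = f g'"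
  have "g (q # l) = g' (q # l)" for l
  proof (rule determines_copy_aux[OF assms])
    show "g (q # l) = g' (q # l)" if "l \<notin> J" for l using off that by blast
    show "copy q D f g = copy q D f g'" if "f \<in> \<F>" for f using eq that by blast
  qed
  note low = this
  show "g = g'"
  proof
    show "g l = g' l" for l
      using off low by (cases "l \<in> (#) q ` J") auto
  qed
qed

text \<open>The indices \<open>i0\<close> and \<open>i1\<close> are two distinguished members of \<open>I\<close>: the variable \<open>x i0\<close>
absorbs the contribution of the variables outside \<open>I\<close>, and \<open>x i1\<close> balances the free shifts of the
other variables in \<open>I\<close>.\<close>

locale translation_invariant_equation =
  fixes s t :: nat and a b :: "nat \<Rightarrow> int" and I :: "nat set" and i0 i1 :: nat
  assumes I: "I \<subseteq> {1..s}" "(\<Sum>i\<in>I. a i) = 0" "i0 \<in> I" "i1 \<in> I" "i0 \<noteq> i1"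
    and nz: "a i0 \<noteq> 0" "a i1 \<noteq> 0"
begin

definition exponent :: nat where
  "exponent = card I + s + t - 2"

definition solution_pattern ::
  "nat list set \<Rightarrow> (nat list \<Rightarrow> nat) \<Rightarrow> ((nat list \<Rightarrow> int) \<Rightarrow> int) set \<Rightarrow>
   (nat \<Rightarrow> (nat list \<Rightarrow> int) \<Rightarrow> int) \<Rightarrow> (nat \<Rightarrow> (nat list \<Rightarrow> int) \<Rightarrow> int) \<Rightarrow> bool" where
  "solution_pattern L \<omega> W X Y \<longleftrightarrow> (\<forall>i\<in>{1..s}. X i \<in> W) \<and> (\<forall>j\<in>{1..t}. Y j \<in> W) \<and>
     (\<forall>g. (\<Sum>i\<in>{1..s}. a i * X i g) = (\<Sum>j\<in>{1..t}. b j * (Y j g)\<^sup>2)) \<and>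
     (\<exists>J\<subseteq>L. exponent \<le> (\<Sum>l\<in>J. \<omega> l) \<and> determines J (X ` {1..s} \<union> Y ` {1..t}))"

text \<open>Positivity is demanded after dilation by any bounded factor, because passing to a larger system
dilates the parameters of its copies.\<close>

definition positive_on_boxes ::
  "nat list set \<Rightarrow> (nat list \<Rightarrow> nat) \<Rightarrow> ((nat list \<Rightarrow> int) \<Rightarrow> int) set \<Rightarrow> bool" where
  "positive_on_boxes L \<omega> W \<longleftrightarrow> (\<forall>c. \<exists>p::nat list \<Rightarrow> nat. \<forall>d\<in>{1..c}. \<forall>B\<ge>1. \<forall>g.
     (\<forall>l\<in>L. int (p l) * B ^ \<omega> l < g l \<and> g l \<le> (int (p l) + 1) * B ^ \<omega> l) \<longrightarrow>
     (\<forall>w\<in>W. w (dilate d g) \<ge> 1))"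

text \<open>Only the number of colours that occur on the values \<open>w g\<close> is bounded. So a system that avoids one
of \<open>Suc r\<close> colours can be treated as coloured with \<open>r\<close> colours.\<close>

definition Ramsey_property ::
  "nat \<Rightarrow> nat list set \<Rightarrow> (nat list \<Rightarrow> nat) \<Rightarrow> ((nat list \<Rightarrow> int) \<Rightarrow> int) set \<Rightarrow> bool" where
  "Ramsey_property r L \<omega> W \<longleftrightarrow>
     (\<forall>g (\<kappa>::int \<Rightarrow> nat) \<Gamma>. finite \<Gamma> \<longrightarrow> card \<Gamma> \<le> r \<longrightarrow> (\<forall>w\<in>W. \<kappa> (w g) \<in> \<Gamma>) \<longrightarrow>
       (\<exists>X Y \<gamma>. solution_pattern L \<omega> W X Y \<and>
          (\<forall>i\<in>{1..s}. \<kappa> (X i g) = \<gamma>) \<and> (\<forall>j\<in>{1..t}. \<kappa> (Y j g) = \<gamma>)))"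

text \<open>Since each member of \<open>W\<close> determines a coordinate of positive weight, elements taken from
disjoint copies of the system contribute at least 1 each to the total weight of a solution.\<close>

definition Ramsey_system ::
  "nat \<Rightarrow> nat list set \<Rightarrow> (nat list \<Rightarrow> nat) \<Rightarrow> nat \<Rightarrow> ((nat list \<Rightarrow> int) \<Rightarrow> int) set \<Rightarrow> bool" where
  "Ramsey_system r L \<omega> k W \<longleftrightarrow> finite L \<and> finite W \<and> W \<noteq> {} \<and>
     (\<forall>w\<in>W. weighted_poly L \<omega> k w \<and> (\<exists>l\<in>L. \<omega> l \<ge> 1 \<and> determines {l} {w})) \<and>
     positive_on_boxes L \<omega> W \<and> Ramsey_property r L \<omega> W"

lemma Ramsey_propertyD:
  fixes \<kappa> :: "int \<Rightarrow> nat"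
  assumes "Ramsey_property r L \<omega> W" "finite \<Gamma>" "card \<Gamma> \<le> r" "\<And>w. w \<in> W \<Longrightarrow> \<kappa> (w g) \<in> \<Gamma>"
  shows "\<exists>X Y \<gamma>. solution_pattern L \<omega> W X Y \<and>
      (\<forall>i\<in>{1..s}. \<kappa> (X i g) = \<gamma>) \<and> (\<forall>j\<in>{1..t}. \<kappa> (Y j g) = \<gamma>)"
  by (rule assms(1)[unfolded Ramsey_property_def, rule_format]) (fact assms)+

text \<open>With no colours at all, a single element cannot be coloured, so the Ramsey property holds vacuously.
This element is the seed of the construction.\<close>

lemma Ramsey_system_0: "Ramsey_system 0 {[]} (\<lambda>_. 1) 1 {\<lambda>g. g []}"
proof -
  have "positive_on_boxes {[]} (\<lambda>_. 1) {\<lambda>g. g []}"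
    unfolding positive_on_boxes_def
  proof (intro allI exI[of _ "\<lambda>_. 0"] ballI impI)
    fix c d :: nat and B :: int and g :: "nat list \<Rightarrow> int" and w :: "(nat list \<Rightarrow> int) \<Rightarrow> int"
    assume d: "d \<in> {1..c}"
      and *: "\<forall>l\<in>{[]}. int 0 * B ^ 1 < g l \<and> g l \<le> (int 0 + 1) * B ^ 1" "w \<in> {\<lambda>g. g []}"
    have "0 < int d * g []" using d * by (intro mult_pos_pos) auto
    then show "1 \<le> w (dilate d g)" using *(2) by simp
  qed
  moreover have "determines {[]} {\<lambda>g. g []}"
    unfolding determines_def
  proof (intro allI impI ext, elim conjE)
    fix g g' :: "nat list \<Rightarrow> int" and l
    assume "\<forall>l. l \<notin> {[]} \<longrightarrow> g l = g' l" "\<forall>f\<in>{\<lambda>g. g []}. f g = f g'"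
    then show "g l = g' l" by (cases "l = []") simp_all
  qed
  moreover have "weighted_poly {[]} (\<lambda>_. 1) 1 (\<lambda>g. g [])" by (rule weighted_poly_coordinate) simp_all
  moreover have "Ramsey_property 0 {[]} (\<lambda>_. 1) {\<lambda>g. g []}"
    unfolding Ramsey_property_def by (intro allI impI) auto
  ultimately show ?thesis
    unfolding Ramsey_system_def by simp
qed

text \<open>The induction step described at the beginning. The new set \<open>W'\<close> consists of the possible points
\<open>g [] + u g\<close> near a base point, and of the old functions on independent copies of the old parameters,
dilated by \<open>d * A\<close>. The factor \<open>A = \<bar>a i0\<bar>\<close> makes everything that comes from the copies divisible by
\<open>a i0\<close>, so that \<open>x i0\<close> can absorb it. The members of \<open>I\<close> other than \<open>i0\<close> and \<open>i1\<close> get a free shift each; without these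
shifts the number of parameters would be too small for the weight \<open>exponent\<close>.\<close>

lemma Ramsey_system_Suc:
  assumes sys: "Ramsey_system r L \<omega> k W" and k: "k \<ge> 1"
  shows "\<exists>L' \<omega>' W'. Ramsey_system (Suc r) L' \<omega>' (2 * k) W'"
proof -
  have finL: "finite L" and finW: "finite W" and W0: "W \<noteq> {}"
    and wW: "\<And>w. w \<in> W \<Longrightarrow> weighted_poly L \<omega> k w"
    and detW: "\<And>w. w \<in> W \<Longrightarrow> \<exists>l\<in>L. \<omega> l \<ge> 1 \<and> determines {l} {w}"
    and posW: "positive_on_boxes L \<omega> W"
    and Ramsey: "Ramsey_property r L \<omega> W"
    using sys unfolding Ramsey_system_def by simp_all
  define A where "A = nat \<bar>a i0\<bar>"
  have A: "A \<ge> 1" "int A = a i0 * sgn (a i0)" using nz by (simp_all add: A_def abs_mult_sgn flip: abs_sgn)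
  define I2 where "I2 = I - {i0, i1}"
  have finI: "finite I" using I(1) finite_subset by blast
  have I_eq: "I = insert i0 (insert i1 I2)" and I2: "finite I2" "i0 \<notin> insert i1 I2" "i1 \<notin> I2"
    using I finI by (auto simp: I2_def)
  have cardI: "card I = Suc (Suc (card I2))"
    unfolding I_eq using I2 by simp
  have sumI: "(\<Sum>i\<in>I. F i) = F i0 + (F i1 + (\<Sum>i\<in>I2. F i))" for F :: "nat \<Rightarrow> int"
    unfolding I_eq using I2 by simp
  \<comment> \<open>One copy for each variable outside \<open>I\<close>; the variable \<open>y j\<close> gets the copy \<open>s + j\<close>.\<close>
  define Q where "Q = ({1..s} - I) \<union> {s+1..s+t}"
  have finQ: "finite Q" by (simp add: Q_def)
  have cardQ: "card Q + card I = s + t"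
  proof -
    have "card Q = card ({1..s} - I) + card {s+1..s+t}"
      unfolding Q_def by (rule card_Un_disjoint) auto
    moreover have "card ({1..s} - I) = s - card I" "card I \<le> s"
      using card_Diff_subset[OF finI I(1)] card_mono[OF _ I(1)] by auto
    ultimately show ?thesis by simp
  qed
  have I2Q: "I2 \<inter> Q = {}" using I(1) by (auto simp: I2_def Q_def)
  define L' where "L' = {[]} \<union> (\<lambda>i. [i]) ` I2 \<union> (\<lambda>(q, l). q # l) ` (Q \<times> L)"
  define \<omega>' where "\<omega>' m = (case m of [] \<Rightarrow> 2 * k | q # l \<Rightarrow> if q \<in> Q then \<omega> l else 2 * k)" for m
  have [simp]: "\<omega>' [] = 2 * k" "\<And>q l. q \<in> Q \<Longrightarrow> \<omega>' (q # l) = \<omega> l" "\<And>i l. i \<in> I2 \<Longrightarrow> \<omega>' (i # l) = 2 * k"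
    using I2Q by (auto simp: \<omega>'_def)
  \<comment> \<open>The label \<open>[]\<close> belongs to the base point. All other functions avoid it, so that a point \<open>g [] + u g\<close> determines \<open>g []\<close> when the other coordinates are known.\<close>
  define L0 where "L0 = L' - {[]}"
  have L0: "[] \<notin> L0" "L0 \<subseteq> L'" "\<And>q l. q \<in> Q \<Longrightarrow> l \<in> L \<Longrightarrow> q # l \<in> L0" "\<And>i. i \<in> I2 \<Longrightarrow> [i] \<in> L0"
    by (auto simp: L0_def L'_def)
  have L1: "[] \<in> L'" "\<And>q l. q \<in> Q \<Longrightarrow> l \<in> L \<Longrightarrow> q # l \<in> L'" "\<And>i. i \<in> I2 \<Longrightarrow> [i] \<in> L'"
    by (auto simp: L'_def)
  have finL': "finite L'" using finL finQ finI by (simp add: L'_def I2_def)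
  define Z where "Z = PiE Q (\<lambda>_. W)"
  have finZ: "finite Z" unfolding Z_def using finQ finW by (intro finite_PiE)
  have up: "weighted_poly L0 \<omega>' k (copy q D w)" if "w \<in> W" "q \<in> Q" for q w D
  proof -
    have "weighted_poly L0 \<omega>' k (\<lambda>g. w (\<lambda>l. g (q # l)))"
      by (rule weighted_poly_relabel[OF wW[OF that(1)]]) (use L0 that in auto)
    from weighted_poly_dilate[OF this, of D] show ?thesis by (simp add: copy_def)
  qed
  \<comment> \<open>The required value of \<open>\<Sum>i\<in>I. a i * x i\<close> if \<open>\<zeta>\<close> picks the elements of the copies.\<close>
  define n where "n \<zeta> g = (\<Sum>j\<in>{1..t}. b j * (copy (s + j) 1 (\<zeta> (s + j)) g * copy (s + j) 1 (\<zeta> (s + j)) g))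
      - (\<Sum>i\<in>{1..s} - I. a i * copy i 1 (\<zeta> i) g)" for \<zeta> g
  have n: "weighted_poly L0 \<omega>' (2 * k) (n \<zeta>)" if "\<zeta> \<in> Z" for \<zeta>
    unfolding n_def
  proof (intro weighted_poly_diff weighted_poly_sum weighted_poly_cmult)
    have mem: "\<zeta> q \<in> W" if "q \<in> Q" for q using \<open>\<zeta> \<in> Z\<close> that by (auto simp: Z_def)
    show "weighted_poly L0 \<omega>' (2 * k) (\<lambda>g. copy (s + j) 1 (\<zeta> (s + j)) g * copy (s + j) 1 (\<zeta> (s + j)) g)"
      if "j \<in> {1..t}" for j
    proof -
      have "s + j \<in> Q" using that by (simp add: Q_def)
      then have "weighted_poly L0 \<omega>' k (copy (s + j) 1 (\<zeta> (s + j)))" by (intro up mem)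
      from weighted_poly_mult[OF this this] show ?thesis by (simp add: mult_2)
    qed
    show "weighted_poly L0 \<omega>' (2 * k) (copy i 1 (\<zeta> i))" if "i \<in> {1..s} - I" for i
    proof (rule weighted_poly_mono)
      have "i \<in> Q" using that by (simp add: Q_def)
      then show "weighted_poly L0 \<omega>' k (copy i 1 (\<zeta> i))" by (intro up mem)
    qed simp
  qed
  have "\<forall>\<zeta>\<in>Z. \<exists>f'. weighted_poly L0 \<omega>' (2 * k) f' \<and> (\<forall>g. n \<zeta> (dilate A g) = int A * f' g)"
    using weighted_poly_dilate_divisible[OF n] by blast
  then obtain m where m: "\<And>\<zeta>. \<zeta> \<in> Z \<Longrightarrow> weighted_poly L0 \<omega>' (2 * k) (m \<zeta>)"
    "\<And>\<zeta> g. \<zeta> \<in> Z \<Longrightarrow> n \<zeta> (dilate A g) = int A * m \<zeta> g" by metis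
  \<comment> \<open>Shifts of \<open>x i0\<close>, of \<open>x i1\<close> and of the other \<open>x i\<close>. The last two kinds cancel in the equation.\<close>
  define f0 where "f0 \<zeta> g = sgn (a i0) * m \<zeta> g" for \<zeta> g
  define f1 where "f1 g = - (\<Sum>i\<in>I2. a i * g [i])" for g :: "nat list \<Rightarrow> int"
  define f2 where "f2 i g = a i1 * g [i]" for i and g :: "nat list \<Rightarrow> int"
  define \<F> where "\<F> = f0 ` Z \<union> {f1} \<union> f2 ` I2"
  have coord: "weighted_poly L0 \<omega>' (2 * k) (\<lambda>g. g [i])" if "i \<in> I2" for i
    by (rule weighted_poly_coordinate) (use that L0 in auto)
  have f1: "weighted_poly L0 \<omega>' (2 * k) f1"
  proof -
    have "weighted_poly L0 \<omega>' (2 * k) (\<lambda>g. (- 1) * (\<Sum>i\<in>I2. a i * g [i]))"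
      by (intro weighted_poly_cmult weighted_poly_sum coord)
    then show ?thesis by (simp add: f1_def[abs_def])
  qed
  have wp\<F>: "\<forall>f\<in>\<F>. weighted_poly L0 \<omega>' (2 * k) f"
    using m(1) f1 coord unfolding \<F>_def f0_def[abs_def] f2_def[abs_def]
    by (auto intro!: weighted_poly_cmult)
  have fin\<F>: "finite \<F>" using finZ finI by (simp add: \<F>_def I2_def)
  obtain \<O> K where \<O>: "finite \<O>" "\<forall>u\<in>\<O>. weighted_poly L0 \<omega>' (2 * k) u" and
    vdW: "\<forall>x g (\<kappa>::int \<Rightarrow> nat) \<Gamma>. finite \<Gamma> \<and> card \<Gamma> \<le> Suc r \<and> (\<forall>u\<in>\<O>. \<kappa> (x + u g) \<in> \<Gamma>) \<longrightarrow>
      (\<exists>u\<in>\<O>. \<exists>d\<in>{1..K}. \<forall>f\<in>\<F>. (\<lambda>g. u g + f (dilate d g)) \<in> \<O> \<and>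
         \<kappa> (x + (u g + f (dilate d g))) = \<kappa> (x + u g))"
    using weighted_poly_van_der_Waerden[OF fin\<F> wp\<F>, of "Suc r"]
    by (elim exE conjE) (rule that, assumption+)
  define apex where "apex u g = g [] + u g" for u and g :: "nat list \<Rightarrow> int"
  define W' where "W' = apex ` \<O> \<union> (\<lambda>(q, d, w). copy q (d * A) w) ` (Q \<times> {1..K} \<times> W)"
  have finW': "finite W'" using \<O>(1) finQ finW by (simp add: W'_def)
  have apexW: "\<And>u. u \<in> \<O> \<Longrightarrow> apex u \<in> W'" by (simp add: W'_def)
  have copyW: "\<And>q d w. q \<in> Q \<Longrightarrow> d \<in> {1..K} \<Longrightarrow> w \<in> W \<Longrightarrow> copy q (d * A) w \<in> W'"
    unfolding W'_def by force
  have W'_cases: "(\<exists>u\<in>\<O>. w = apex u) \<or> (\<exists>q\<in>Q. \<exists>d\<in>{1..K}. \<exists>v\<in>W. w = copy q (d * A) v)" if "w \<in> W'" for w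
    using that unfolding W'_def by auto
  have L0_sub: "weighted_poly L' \<omega>' (2 * k) f" if "weighted_poly L0 \<omega>' (2 * k) f" for f
    using weighted_poly_relabel[OF that, of "\<lambda>l. l" L' \<omega>'] L0(2) by auto
  have O0: "\<O> \<noteq> {}" using vdW[rule_format, of "{0}" "\<lambda>_. 0"] by auto
  have Ramsey': "\<exists>X Y \<gamma>. solution_pattern L' \<omega>' W' X Y \<and>
          (\<forall>i\<in>{1..s}. \<kappa> (X i g) = \<gamma>) \<and> (\<forall>j\<in>{1..t}. \<kappa> (Y j g) = \<gamma>)"
    if \<Gamma>: "finite \<Gamma>" "card \<Gamma> \<le> Suc r" and \<kappa>: "\<And>w. w \<in> W' \<Longrightarrow> \<kappa> (w g) \<in> \<Gamma>"
    for g \<Gamma> and \<kappa> :: "int \<Rightarrow> nat"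
  proof -
    have "\<forall>u\<in>\<O>. \<kappa> (g [] + u g) \<in> \<Gamma>" using \<kappa>[OF apexW] by (simp add: apex_def)
    from vdW[rule_format, OF conjI[OF \<Gamma>(1) conjI[OF \<Gamma>(2) this]]] obtain u d where
      u: "u \<in> \<O>" and d: "d \<in> {1..K}" and
      ud: "\<And>f. f \<in> \<F> \<Longrightarrow> (\<lambda>g. u g + f (dilate d g)) \<in> \<O> \<and>
         \<kappa> (g [] + (u g + f (dilate d g))) = \<kappa> (g [] + u g)" by blast
    define \<gamma> where "\<gamma> = \<kappa> (g [] + u g)"
    have \<gamma>: "\<gamma> \<in> \<Gamma>" using \<kappa>[OF apexW[OF u]] by (simp add: apex_def \<gamma>_def)
    have dA: "d * A \<ge> 1" using d A(1) by simp
    show ?thesis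
    \<comment> \<open>Either some copy misses the colour \<open>\<gamma>\<close> and the induction hypothesis applies to it, or every copy offers an element of this colour.\<close>
    proof (cases "\<exists>q\<in>Q. \<forall>w\<in>W. \<kappa> (copy q (d * A) w g) \<noteq> \<gamma>")
      case True
      then obtain q where q: "q \<in> Q" "\<forall>w\<in>W. \<kappa> (copy q (d * A) w g) \<noteq> \<gamma>" by blast
      have "\<exists>X Y \<delta>. solution_pattern L \<omega> W X Y \<and>
          (\<forall>i\<in>{1..s}. \<kappa> (X i (\<lambda>l. int (d * A) * g (q # l))) = \<delta>) \<and>
          (\<forall>j\<in>{1..t}. \<kappa> (Y j (\<lambda>l. int (d * A) * g (q # l))) = \<delta>)"
      proof (rule Ramsey_propertyD[OF Ramsey])
        show "finite (\<Gamma> - {\<gamma>})" "card (\<Gamma> - {\<gamma>}) \<le> r" using \<Gamma> \<gamma> by simp_all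
        show "\<kappa> (w (\<lambda>l. int (d * A) * g (q # l))) \<in> \<Gamma> - {\<gamma>}" if "w \<in> W" for w
          using q(2) \<kappa>[OF copyW[OF q(1) d that]] that by (simp add: copy_def)
      qed
      then obtain X Y \<delta> where XY: "solution_pattern L \<omega> W X Y"
          "\<forall>i\<in>{1..s}. \<kappa> (X i (\<lambda>l. int (d * A) * g (q # l))) = \<delta>"
          "\<forall>j\<in>{1..t}. \<kappa> (Y j (\<lambda>l. int (d * A) * g (q # l))) = \<delta>" by blast
      define X' where "X' i = copy q (d * A) (X i)" for i
      define Y' where "Y' j = copy q (d * A) (Y j)" for j
      obtain J where J: "J \<subseteq> L" "exponent \<le> (\<Sum>l\<in>J. \<omega> l)" "determines J (X ` {1..s} \<union> Y ` {1..t})"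
        using XY(1) unfolding solution_pattern_def by blast
      have "solution_pattern L' \<omega>' W' X' Y'"
        unfolding solution_pattern_def
      proof (intro conjI ballI allI exI[of _ "(#) q ` J"])
        show "X' i \<in> W'" if "i \<in> {1..s}" for i
          unfolding X'_def by (rule copyW[OF q(1) d]) (use XY(1) that in \<open>simp add: solution_pattern_def\<close>)
        show "Y' i \<in> W'" if "i \<in> {1..t}" for i
          unfolding Y'_def by (rule copyW[OF q(1) d]) (use XY(1) that in \<open>simp add: solution_pattern_def\<close>)
        show "(\<Sum>i\<in>{1..s}. a i * X' i g) = (\<Sum>j\<in>{1..t}. b j * (Y' j g)\<^sup>2)" for g
          using XY(1) unfolding X'_def Y'_def copy_def solution_pattern_def by blast
        show "(#) q ` J \<subseteq> L'" using L1(2)[OF q(1)] J(1) by blast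
        have "(\<Sum>l\<in>(#) q ` J. \<omega>' l) = (\<Sum>l\<in>J. \<omega> l)"
          using q(1) by (subst sum.reindex) (auto simp: inj_on_def)
        then show "exponent \<le> (\<Sum>l\<in>(#) q ` J. \<omega>' l)" using J(2) by simp
        have "X' ` {1..s} \<union> Y' ` {1..t} = copy q (d * A) ` (X ` {1..s} \<union> Y ` {1..t})"
          by (auto simp: X'_def Y'_def)
        then show "determines ((#) q ` J) (X' ` {1..s} \<union> Y' ` {1..t})"
          using determines_copy[OF J(3) dA] by simp
      qed
      moreover have "\<forall>i\<in>{1..s}. \<kappa> (X' i g) = \<delta>" "\<forall>j\<in>{1..t}. \<kappa> (Y' j g) = \<delta>"
        unfolding X'_def Y'_def copy_def by (fact XY(2,3))+
      ultimately show ?thesis by blast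
    next
      case False
      then have "\<forall>q\<in>Q. \<exists>w. w \<in> W \<and> \<kappa> (copy q (d * A) w g) = \<gamma>" by blast
      then obtain \<zeta>' where \<zeta>': "\<And>q. q \<in> Q \<Longrightarrow> \<zeta>' q \<in> W \<and> \<kappa> (copy q (d * A) (\<zeta>' q) g) = \<gamma>" by metis
      define \<zeta> where "\<zeta> = restrict \<zeta>' Q"
      have \<zeta>: "\<zeta> \<in> Z" "\<And>q. q \<in> Q \<Longrightarrow> \<zeta> q \<in> W" "\<And>q. q \<in> Q \<Longrightarrow> \<kappa> (copy q (d * A) (\<zeta> q) g) = \<gamma>"
        using \<zeta>' by (auto simp: \<zeta>_def Z_def)
      have mem\<F>: "f0 \<zeta> \<in> \<F>" "f1 \<in> \<F>" "\<And>i. i \<in> I2 \<Longrightarrow> f2 i \<in> \<F>" using \<zeta>(1) by (auto simp: \<F>_def)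
      define \<phi> where "\<phi> i = (if i = i0 then f0 \<zeta> else if i = i1 then f1 else f2 i)" for i
      have \<phi>: "\<phi> i \<in> \<F>" if "i \<in> I" for i
        using that mem\<F> by (auto simp: \<phi>_def I2_def)
      define X where "X i = (if i \<in> I then apex (\<lambda>g. u g + \<phi> i (dilate d g)) else copy i (d * A) (\<zeta> i))" for i
      define Y where "Y j = copy (s + j) (d * A) (\<zeta> (s + j))" for j
      have "\<forall>q\<in>Q. \<exists>l. l \<in> L \<and> \<omega> l \<ge> 1 \<and> determines {l} {\<zeta> q}" using detW \<zeta>(2) by blast
      then obtain piv where piv: "\<And>q. q \<in> Q \<Longrightarrow> piv q \<in> L \<and> \<omega> (piv q) \<ge> 1 \<and> determines {piv q} {\<zeta> q}" by metis
      define J where "J = insert [] ((\<lambda>i. [i]) ` I2 \<union> (\<lambda>q. q # piv q) ` Q)"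
      have eq: "(\<Sum>i\<in>{1..s}. a i * X i h) = (\<Sum>j\<in>{1..t}. b j * (Y j h)\<^sup>2)" for h
      proof -
        have copyA: "copy q 1 f (dilate A (dilate d h)) = copy q (d * A) f h" for q f
          by (simp add: copy_def mult_ac)
        have nA: "n \<zeta> (dilate A (dilate d h)) = (\<Sum>j\<in>{1..t}. b j * (Y j h)\<^sup>2) - (\<Sum>i\<in>{1..s} - I. a i * X i h)"
          unfolding n_def copyA by (simp add: Y_def X_def power2_eq_square)
        have "(\<Sum>i\<in>I. a i * X i h) = (\<Sum>i\<in>I. a i * (h [] + u h)) + (\<Sum>i\<in>I. a i * \<phi> i (dilate d h))"
          by (simp add: X_def apex_def algebra_simps sum.distrib)
        also have "(\<Sum>i\<in>I. a i * (h [] + u h)) = 0"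
          using I(2) by (simp flip: sum_distrib_right)
        also have "(\<Sum>i\<in>I. a i * \<phi> i (dilate d h)) = a i0 * f0 \<zeta> (dilate d h) + (a i1 * f1 (dilate d h)
            + (\<Sum>i\<in>I2. a i * f2 i (dilate d h)))"
        proof -
          have "(\<Sum>i\<in>I2. a i * \<phi> i (dilate d h)) = (\<Sum>i\<in>I2. a i * f2 i (dilate d h))"
            by (rule sum.cong) (auto simp: \<phi>_def I2_def)
          moreover have "\<phi> i0 = f0 \<zeta>" "\<phi> i1 = f1" using I(5) by (simp_all add: \<phi>_def)
          ultimately show ?thesis unfolding sumI by simp
        qed
        also have "a i1 * f1 (dilate d h) + (\<Sum>i\<in>I2. a i * f2 i (dilate d h)) = 0"
          by (simp add: f1_def f2_def sum_distrib_left mult_ac)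
        also have "a i0 * f0 \<zeta> (dilate d h) = n \<zeta> (dilate A (dilate d h))"
          using m(2)[OF \<zeta>(1)] A(2) by (simp add: f0_def)
        finally have "(\<Sum>i\<in>I. a i * X i h) = n \<zeta> (dilate A (dilate d h))" by simp
        moreover have "(\<Sum>i\<in>{1..s}. a i * X i h) = (\<Sum>i\<in>{1..s} - I. a i * X i h) + (\<Sum>i\<in>I. a i * X i h)"
          by (rule sum.subset_diff[OF I(1)]) simp
        ultimately show ?thesis using nA by simp
      qed
      have weight: "exponent \<le> (\<Sum>l\<in>J. \<omega>' l)"
      proof -
        have "(\<Sum>l\<in>J. \<omega>' l) = 2 * k + (\<Sum>l\<in>(\<lambda>i. [i]) ` I2 \<union> (\<lambda>q. q # piv q) ` Q. \<omega>' l)"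
          unfolding J_def using finI finQ by (subst sum.insert) (auto simp: I2_def)
        also have "(\<Sum>l\<in>(\<lambda>i. [i]) ` I2 \<union> (\<lambda>q. q # piv q) ` Q. \<omega>' l) =
            (\<Sum>l\<in>(\<lambda>i. [i]) ` I2. \<omega>' l) + (\<Sum>l\<in>(\<lambda>q. q # piv q) ` Q. \<omega>' l)"
          using finI finQ I2Q by (intro sum.union_disjoint) (auto simp: I2_def)
        also have "(\<Sum>l\<in>(\<lambda>i. [i]) ` I2. \<omega>' l) = card I2 * (2 * k)"
          by (subst sum.reindex) (auto simp: inj_on_def)
        also have "(\<Sum>l\<in>(\<lambda>q. q # piv q) ` Q. \<omega>' l) = (\<Sum>q\<in>Q. \<omega> (piv q))"
          by (subst sum.reindex) (auto simp: inj_on_def)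
        finally have sumJ: "(\<Sum>l\<in>J. \<omega>' l) = 2 * k + (card I2 * (2 * k) + (\<Sum>q\<in>Q. \<omega> (piv q)))" .
        have "card Q \<le> (\<Sum>q\<in>Q. \<omega> (piv q))"
          using sum_mono[of Q "\<lambda>_. 1" "\<lambda>q. \<omega> (piv q)"] piv by simp
        moreover have "card I2 * 2 \<le> card I2 * (2 * k)" using k by simp
        ultimately show ?thesis
          unfolding exponent_def sumJ using cardQ cardI k by linarith
      qed
      \<comment> \<open>The elements of the copies are coordinates of the solution, which recovers the copies up to their known coordinates. Then \<open>x i0\<close> gives the base point, the other \<open>x i\<close> give the free shifts, and at last \<open>g []\<close> can be read off from the base point.\<close>
      have det: "determines J (X ` {1..s} \<union> Y ` {1..t})"
        unfolding determines_def
      proof (intro allI impI, elim conjE)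
        fix h h' assume off: "\<forall>l. l \<notin> J \<longrightarrow> h l = h' l" and eq: "\<forall>f\<in>X ` {1..s} \<union> Y ` {1..t}. f h = f h'"
        have eqX: "X i h = X i h'" if "i \<in> {1..s}" for i using eq that by blast
        have eqY: "Y i h = Y i h'" if "i \<in> {1..t}" for i using eq that by blast
        have low: "h (q # l) = h' (q # l)" if "q \<in> Q" for q l
        proof (rule determines_copy_aux[of "{piv q}" "{\<zeta> q}" "d * A"])
          show "determines {piv q} {\<zeta> q}" using piv that by blast
          show "h (q # l) = h' (q # l)" if "l \<notin> {piv q}" for l
            using off that \<open>q \<in> Q\<close> I2Q by (auto simp: J_def)
          have "copy q (d * A) (\<zeta> q) h = copy q (d * A) (\<zeta> q) h'"
          proof (cases "q \<le> s")
            case True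
            then have "q \<in> {1..s}" "q \<notin> I" using that I(1) by (auto simp: Q_def)
            then show ?thesis using eqX[of q] by (simp add: X_def)
          next
            case False
            then have "q - s \<in> {1..t}" "s + (q - s) = q" using that by (auto simp: Q_def)
            then show ?thesis using eqY[of "q - s"] by (simp add: Y_def)
          qed
          then show "copy q (d * A) f h = copy q (d * A) f h'" if "f \<in> {\<zeta> q}" for f using that by simp
        qed (rule dA)
        have nn: "n \<zeta> (dilate A (dilate d h)) = n \<zeta> (dilate A (dilate d h'))"
        proof -
          have "copy q 1 f (dilate A (dilate d h)) = copy q 1 f (dilate A (dilate d h'))" if "q \<in> Q" for q f
            using low[OF that] by (simp add: copy_def)
          then show ?thesis unfolding n_def
            by (intro arg_cong2[where f = "(-)"] sum.cong) (auto simp: Q_def)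
        qed
        have "m \<zeta> (dilate d h) = m \<zeta> (dilate d h')" using nn m(2)[OF \<zeta>(1)] A(1) by simp
        moreover have "X i0 h = X i0 h'" using eqX I by blast
        ultimately have base: "h [] + u h = h' [] + u h'"
          using I(3) by (simp add: X_def \<phi>_def f0_def apex_def)
        have mid: "h [i] = h' [i]" if "i \<in> I2" for i
        proof -
          have i: "i \<in> I" "i \<noteq> i0" "i \<noteq> i1" "i \<in> {1..s}" using that I(1) by (auto simp: I2_def)
          have "h [] + (u h + a i1 * (int d * h [i])) = h' [] + (u h' + a i1 * (int d * h' [i]))"
            using eqX[OF i(4)] i by (simp add: X_def \<phi>_def apex_def f2_def)
          then have "a i1 * (int d * h [i]) = a i1 * (int d * h' [i])" using base by linarith
          then show ?thesis using nz d by simp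
        qed
        have other: "h l = h' l" if "l \<noteq> []" for l
        proof (cases "l \<in> J")
          case True
          then show ?thesis using that low mid by (auto simp: J_def)
        qed (use off in blast)
        have "u h = u h'" by (rule weighted_poly_cong[OF bspec[OF \<O>(2) u]]) (use other L0(1) in metis)
        then have "h [] = h' []" using base by simp
        then show "h = h'" using other by (intro ext) metis
      qed
      have "solution_pattern L' \<omega>' W' X Y"
        unfolding solution_pattern_def
      proof (intro conjI ballI allI exI[of _ J] eq weight det)
        show "X i \<in> W'" if "i \<in> {1..s}" for i
        proof (cases "i \<in> I")
          case True
          then show ?thesis unfolding X_def using apexW ud \<phi> by simp
        next
          case False
          then have "i \<in> Q" using that by (simp add: Q_def)
          then show ?thesis unfolding X_def using False copyW[OF _ d \<zeta>(2)] by simp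
        qed
        show "Y j \<in> W'" if "j \<in> {1..t}" for j
          unfolding Y_def by (rule copyW[OF _ d \<zeta>(2)]) (use that in \<open>auto simp: Q_def\<close>)
        show "J \<subseteq> L'" using L1 piv by (auto simp: J_def)
      qed
      moreover have "\<kappa> (X i g) = \<gamma>" if "i \<in> {1..s}" for i
      proof (cases "i \<in> I")
        case True
        then show ?thesis using ud[OF \<phi>[OF True]] by (simp add: X_def apex_def \<gamma>_def)
      next
        case False
        then show ?thesis using \<zeta>(3)[of i] that by (simp add: X_def Q_def)
      qed
      moreover have "\<kappa> (Y j g) = \<gamma>" if "j \<in> {1..t}" for j
        using \<zeta>(3)[of "s + j"] that by (simp add: Y_def Q_def)
      ultimately show ?thesis by blast
    qed
  qed
  have wp: "weighted_poly L' \<omega>' (2 * k) w" if "w \<in> W'" for w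
    using W'_cases[OF that]
  proof (elim disjE bexE)
    fix u assume "u \<in> \<O>" "w = apex u"
    moreover have "weighted_poly L' \<omega>' (2 * k) (\<lambda>g. g [])" by (rule weighted_poly_coordinate) (simp_all add: L1)
    ultimately show ?thesis using \<O>(2) L0_sub unfolding apex_def[abs_def] by (auto intro: weighted_poly.add)
  next
    fix q d v assume "q \<in> Q" "v \<in> W" "w = copy q (d * A) v"
    then show ?thesis using L0_sub[OF weighted_poly_mono[OF up]] by simp
  qed
  have det: "\<exists>l\<in>L'. \<omega>' l \<ge> 1 \<and> determines {l} {w}" if "w \<in> W'" for w
    using W'_cases[OF that]
  proof (elim disjE bexE)
    fix u assume u: "u \<in> \<O>" "w = apex u"
    have "determines {[]} {w}"
      unfolding determines_def
    proof (intro allI impI, elim conjE)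
      fix h h' assume off: "\<forall>l. l \<notin> {[]} \<longrightarrow> h l = (h' l :: int)" and eq: "\<forall>f\<in>{w}. f h = f h'"
      have "u h = u h'" by (rule weighted_poly_cong[OF bspec[OF \<O>(2) u(1)]]) (use off L0(1) in \<open>metis singletonD\<close>)
      then have "h [] = h' []" using eq u by (simp add: apex_def)
      then show "h = h'" using off by (intro ext) (metis singletonD)
    qed
    then show ?thesis using k by (intro bexI[of _ "[]"]) (simp_all add: L1)
  next
    fix q d v assume *: "q \<in> Q" "d \<in> {1..K}" "v \<in> W" "w = copy q (d * A) v"
    obtain l where l: "l \<in> L" "\<omega> l \<ge> 1" "determines {l} {v}" using detW *(3) by blast
    have "determines {q # l} {w}" using determines_copy[OF l(3), of "d * A" q] * A(1) by simp
    then show ?thesis using l * L1(2) by (intro bexI[of _ "q # l"]) auto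
  qed
  have pos: "positive_on_boxes L' \<omega>' W'"
    unfolding positive_on_boxes_def
  proof
    fix c
    from posW[unfolded positive_on_boxes_def, THEN spec, of "c * (K * A)"]
    obtain p0 :: "nat list \<Rightarrow> nat" where p0: "\<forall>d\<in>{1..c * (K * A)}. \<forall>B\<ge>1. \<forall>g.
      (\<forall>l\<in>L. int (p0 l) * B ^ \<omega> l < g l \<and> g l \<le> (int (p0 l) + 1) * B ^ \<omega> l) \<longrightarrow>
      (\<forall>w\<in>W. w (dilate d g) \<ge> 1)" by (rule exE)
    define M where "M = (\<Sum>l\<in>L. p0 l)"
    have M: "p0 l \<le> M" if "l \<in> L" for l
      unfolding M_def using that finL by (intro member_le_sum) auto
    obtain C where C: "C \<ge> 1" "\<forall>u\<in>\<O>. \<forall>B\<ge>1. \<forall>g.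
      (\<forall>l\<in>L0. \<bar>g l\<bar> \<le> int (c * (M + 1)) * B ^ \<omega>' l) \<longrightarrow> \<bar>u g\<bar> \<le> C * B ^ (2 * k)"
      using weighted_poly_bound_common[OF \<O>(1), of L0 \<omega>' "2 * k" "int (c * (M + 1))"] \<O>(2) by blast
    \<comment> \<open>The new coordinate \<open>g []\<close> has to exceed all offsets \<open>u g\<close>, so its box is moved up to the bound for them.\<close>
    define p where "p m = (case m of [] \<Rightarrow> nat C | q # l \<Rightarrow> if q \<in> Q then p0 l else 0)" for m
    have pos: "w (dilate d g) \<ge> 1"
      if d: "d \<in> {1..c}" and B: "B \<ge> 1" and w: "w \<in> W'"
        and g: "\<forall>l\<in>L'. int (p l) * B ^ \<omega>' l < g l \<and> g l \<le> (int (p l) + 1) * B ^ \<omega>' l"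
      for d B g w
      using W'_cases[OF w]
    proof (elim disjE bexE)
      fix u assume u: "u \<in> \<O>" "w = apex u"
      have "\<bar>dilate d g l\<bar> \<le> int (c * (M + 1)) * B ^ \<omega>' l" if l: "l \<in> L0" for l
      proof -
        have "p l \<le> M" using l M I2Q by (auto simp: L0_def L'_def p_def)
        have gl: "int (p l) * B ^ \<omega>' l < g l" "g l \<le> (int (p l) + 1) * B ^ \<omega>' l" using g l L0(2) by auto
        have "0 \<le> int (p l) * B ^ \<omega>' l" using B by simp
        then have "\<bar>dilate d g l\<bar> = int d * g l" using gl by (simp add: abs_mult)
        also have "\<dots> \<le> int c * ((int (p l) + 1) * B ^ \<omega>' l)"
          using gl d \<open>0 \<le> int (p l) * B ^ \<omega>' l\<close> by (intro mult_mono) auto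
        also have "\<dots> \<le> int c * ((int M + 1) * B ^ \<omega>' l)"
          using \<open>p l \<le> M\<close> B by (intro mult_left_mono mult_right_mono) auto
        finally show ?thesis by (simp add: algebra_simps)
      qed
      then have "\<bar>u (dilate d g)\<bar> \<le> C * B ^ (2 * k)" using C(2)[rule_format, OF u(1) B, of "dilate d g"] by blast
      moreover have "C * B ^ (2 * k) < g []" using g[rule_format, OF L1(1)] C(1) by (simp add: p_def)
      moreover have "0 \<le> C * B ^ (2 * k)" using C(1) B by simp
      ultimately have "0 < g []" by linarith
      then have "g [] \<le> int d * g []" using d by (simp add: mult_le_cancel_right1)
      then show ?thesis
        using \<open>\<bar>u (dilate d g)\<bar> \<le> C * B ^ (2 * k)\<close> \<open>C * B ^ (2 * k) < g []\<close> by (simp add: u(2) apex_def)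
    next
      fix q e v assume *: "q \<in> Q" "e \<in> {1..K}" "v \<in> W" "w = copy q (e * A) v"
      have "1 \<le> v (dilate (d * (e * A)) (\<lambda>l. g (q # l)))"
      proof (rule p0[rule_format, OF _ B _ *(3)])
        show "d * (e * A) \<in> {1..c * (K * A)}"
          using d *(2) A(1) by (simp add: mult_le_mono)
        show "int (p0 l) * B ^ \<omega> l < g (q # l) \<and> g (q # l) \<le> (int (p0 l) + 1) * B ^ \<omega> l" if "l \<in> L" for l
          using g[rule_format, of "q # l"] *(1) L1(2)[OF *(1) that] by (simp add: p_def)
      qed
      then show ?thesis by (simp add: *(4) copy_def mult_ac)
    qed
    show "\<exists>p::nat list \<Rightarrow> nat. \<forall>d\<in>{1..c}. \<forall>B\<ge>1. \<forall>g.
     (\<forall>l\<in>L'. int (p l) * B ^ \<omega>' l < g l \<and> g l \<le> (int (p l) + 1) * B ^ \<omega>' l) \<longrightarrow>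
     (\<forall>w\<in>W'. w (dilate d g) \<ge> 1)"
      by (intro exI[of _ p] ballI allI impI) (rule pos)
  qed
  have "Ramsey_property (Suc r) L' \<omega>' W'"
    unfolding Ramsey_property_def by (intro allI impI) (rule Ramsey', blast+)
  moreover have "W' \<noteq> {}" using O0 apexW by auto
  ultimately have "Ramsey_system (Suc r) L' \<omega>' (2 * k) W'"
    unfolding Ramsey_system_def using finL' finW' wp det pos by simp
  then show ?thesis by blast
qed

lemma Ramsey_system_exists: "\<exists>L \<omega> W. Ramsey_system r L \<omega> (2 ^ r) W"
proof (induction r)
  case 0
  show ?case using Ramsey_system_0 by auto
next
  case (Suc r)
  then show ?case using Ramsey_system_Suc[of r _ _ "2 ^ r"] by auto
qed

end

section \<open>Counting monochromatic solutions\<close>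

definition solutions_in ::
  "nat \<Rightarrow> nat \<Rightarrow> (nat \<Rightarrow> int) \<Rightarrow> (nat \<Rightarrow> int) \<Rightarrow> int set \<Rightarrow> ((nat \<Rightarrow> int) \<times> (nat \<Rightarrow> int)) set" where
  "solutions_in s t a b A = solutions s t a b \<inter> ({1..s} \<rightarrow>\<^sub>E A) \<times> ({1..t} \<rightarrow>\<^sub>E A)"

lemma finite_solutions_in:
  assumes "finite A"
  shows "finite (solutions_in s t a b A)"
  unfolding solutions_in_def
  by (rule finite_subset[OF Int_lower2]) (simp add: finite_PiE assms)

lemma solution_count_eq_card:
  assumes "finite A"
  shows "solution_count s t a b A = real (card (solutions_in s t a b A))"
proof -
  let ?f = "\<lambda>(x, y). (\<Prod>i\<in>{1..s}. indicator A (x i)) * (\<Prod>j\<in>{1..t}. indicator A (y j)) :: real"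
  have in1: "?f z = 1" if "z \<in> solutions_in s t a b A" for z
  proof -
    obtain x y where z: "z = (x, y)" by force
    have "\<forall>i\<in>{1..s}. x i \<in> A" "\<forall>j\<in>{1..t}. y j \<in> A"
      using that by (auto simp: z solutions_in_def PiE_iff)
    then show ?thesis by (simp add: z)
  qed
  have out0: "?f z = 0" if "z \<in> solutions s t a b - solutions_in s t a b A" for z
  proof -
    obtain x y where z: "z = (x, y)" by force
    have "\<not> ((\<forall>i\<in>{1..s}. x i \<in> A) \<and> (\<forall>j\<in>{1..t}. y j \<in> A))"
      using that by (auto simp: z solutions_in_def solutions_def PiE_iff)
    then consider i where "i \<in> {1..s}" "x i \<notin> A" | j where "j \<in> {1..t}" "y j \<notin> A" by blast
    then show ?thesis
    proof cases
      case 1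
      then have "(\<Prod>i\<in>{1..s}. indicator A (x i)) = (0 :: real)"
        by (intro prod_zero bexI[of _ i]) simp_all
      then show ?thesis by (simp add: z)
    next
      case 2
      then have "(\<Prod>j\<in>{1..t}. indicator A (y j)) = (0 :: real)"
        by (intro prod_zero bexI[of _ j]) simp_all
      then show ?thesis by (simp add: z)
    qed
  qed
  have "solution_count s t a b A = infsum ?f (solutions s t a b)"
    by (simp add: solution_count_def)
  also have "\<dots> = infsum ?f (solutions_in s t a b A)"
    by (rule infsum_cong_neutral) (use out0 in \<open>auto simp: solutions_in_def\<close>)
  also have "\<dots> = (\<Sum>z\<in>solutions_in s t a b A. ?f z)"
    by (rule infsum_finite[OF finite_solutions_in[OF assms]])
  also have "\<dots> = (\<Sum>z\<in>solutions_in s t a b A. 1)" by (rule sum.cong[OF refl in1])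
  finally show ?thesis by simp
qed

text \<open>Vectors with the same values of \<open>\<F>\<close> differ only if they differ outside \<open>J\<close>, so there are at most as
many of them as there are choices for the coordinates in \<open>L - J\<close>.\<close>

lemma card_determined_fibre:
  fixes p \<omega> :: "nat list \<Rightarrow> nat" and B :: nat
  defines "T \<equiv> (\<lambda>l. {int (p l) * int B ^ \<omega> l <.. (int (p l) + 1) * int B ^ \<omega> l})"
  assumes L: "finite L" and J: "J \<subseteq> L" "determines J \<F>" "e \<le> (\<Sum>l\<in>J. \<omega> l)" and B: "B \<ge> 1"
    and S: "S \<subseteq> PiE L T" and const: "\<And>f g g'. f \<in> \<F> \<Longrightarrow> g \<in> S \<Longrightarrow> g' \<in> S \<Longrightarrow> f g = f g'"
  shows "card S * B ^ e \<le> B ^ (\<Sum>l\<in>L. \<omega> l)"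
proof -
  have cardT: "card (T l) = B ^ \<omega> l" for l
    by (simp add: T_def distrib_right nat_power_eq)
  have inj: "inj_on (\<lambda>g. restrict g (L - J)) S"
  proof (rule inj_onI)
    fix g g' assume gg: "g \<in> S" "g' \<in> S" and eq: "restrict g (L - J) = restrict g' (L - J)"
    show "g = g'"
    proof (rule determinesD[OF J(2)])
      show "f g = f g'" if "f \<in> \<F>" for f using const that gg by blast
      show "g l = g' l" if "l \<notin> J" for l
      proof (cases "l \<in> L")
        case True
        then show ?thesis using fun_cong[OF eq, of l] that by simp
      next
        case False
        then show ?thesis
          using PiE_arb[OF subsetD[OF S gg(1)]] PiE_arb[OF subsetD[OF S gg(2)]] by simp
      qed
    qed
  qed
  have "card S = card ((\<lambda>g. restrict g (L - J)) ` S)" by (rule card_image[OF inj, symmetric])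
  also have "\<dots> \<le> card (PiE (L - J) T)"
  proof (rule card_mono)
    show "finite (PiE (L - J) T)" using L by (intro finite_PiE) (auto simp: T_def)
    show "(\<lambda>g. restrict g (L - J)) ` S \<subseteq> PiE (L - J) T"
    proof (rule image_subsetI)
      fix g assume "g \<in> S"
      then have "g l \<in> T l" if "l \<in> L" for l using PiE_mem[OF subsetD[OF S]] that by blast
      then show "restrict g (L - J) \<in> PiE (L - J) T" by simp
    qed
  qed
  also have "\<dots> = B ^ (\<Sum>l\<in>L - J. \<omega> l)"
    using L by (simp add: card_PiE cardT power_sum)
  finally have "card S * B ^ e \<le> B ^ (\<Sum>l\<in>L - J. \<omega> l) * B ^ (\<Sum>l\<in>J. \<omega> l)"
    using J(3) B by (intro mult_mono power_increasing) auto
  also have "\<dots> = B ^ (\<Sum>l\<in>L. \<omega> l)"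
    using sum.subset_diff[OF J(1) L, of \<omega>] by (simp add: power_add)
  finally show ?thesis .
qed

context translation_invariant_equation
begin

lemma solution_pattern_restrict:
  "solution_pattern L \<omega> W (restrict X {1..s}) (restrict Y {1..t}) \<longleftrightarrow> solution_pattern L \<omega> W X Y"
proof -
  have "restrict X {1..s} ` {1..s} \<union> restrict Y {1..t} ` {1..t} = X ` {1..s} \<union> Y ` {1..t}" by auto
  then show ?thesis by (simp add: solution_pattern_def)
qed

text \<open>Double counting. Each vector in the box yields a monochromatic solution through one of finitely many
patterns, while a pattern sends at most a proportion \<open>B ^ (- exponent)\<close> of the box to a given
solution.\<close>

lemma many_solutions_at_scale:
  assumes sys: "Ramsey_system r L \<omega> k W"
  shows "\<exists>C D :: nat. C \<ge> 1 \<and> (\<forall>(B::nat) (N::nat) Col. B \<ge> 1 \<longrightarrow> C * B ^ k \<le> N \<longrightarrow> colouring r {1..int N} Col \<longrightarrow>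
    (\<exists>j\<in>{1..r}. B ^ exponent \<le> D * card (solutions_in s t a b (Col j))))"
proof -
  have finL: "finite L" and finW: "finite W"
    and wW: "\<And>w. w \<in> W \<Longrightarrow> weighted_poly L \<omega> k w"
    and posW: "positive_on_boxes L \<omega> W"
    and Ramsey: "Ramsey_property r L \<omega> W"
    using sys unfolding Ramsey_system_def by simp_all
  from posW[unfolded positive_on_boxes_def, THEN spec, of 1] obtain p :: "nat list \<Rightarrow> nat" where
    p: "\<forall>d\<in>{1..1}. \<forall>B\<ge>1. \<forall>g.
     (\<forall>l\<in>L. int (p l) * B ^ \<omega> l < g l \<and> g l \<le> (int (p l) + 1) * B ^ \<omega> l) \<longrightarrow>
     (\<forall>w\<in>W. w (dilate d g) \<ge> 1)" by (rule exE)
  define M where "M = (\<Sum>l\<in>L. p l)"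
  have M: "p l \<le> M" if "l \<in> L" for l
    unfolding M_def using that finL by (intro member_le_sum) auto
  obtain C0 where C0: "C0 \<ge> 1" "\<forall>w\<in>W. \<forall>B\<ge>1. \<forall>g.
      (\<forall>l\<in>L. \<bar>g l\<bar> \<le> int (M + 1) * B ^ \<omega> l) \<longrightarrow> \<bar>w g\<bar> \<le> C0 * B ^ k"
    using weighted_poly_bound_common[OF finW wW, of "int (M + 1)"] by blast
  define C where "C = nat C0"
  define P where "P = {(X, Y) \<in> ({1..s} \<rightarrow>\<^sub>E W) \<times> ({1..t} \<rightarrow>\<^sub>E W). solution_pattern L \<omega> W X Y}"
  have finP: "finite P"
    unfolding P_def using finW by (intro finite_Collect_conjI disjI1 finite_subset[OF _ finite_cartesian_product])
      (auto intro!: finite_PiE)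
  define E where "E = (\<Sum>l\<in>L. \<omega> l)"
  have at_scale: "\<exists>j\<in>{1..r}. B ^ exponent \<le> (card P * r) * card (solutions_in s t a b (Col j))"
    if B: "B \<ge> 1" and N: "C * B ^ k \<le> N" and Col: "colouring r {1..int N} Col" for B N Col
  proof -
    define T where "T l = {int (p l) * int B ^ \<omega> l <.. (int (p l) + 1) * int B ^ \<omega> l}" for l
    define box where "box = PiE L T"
    have finbox: "finite box" unfolding box_def using finL by (intro finite_PiE) (auto simp: T_def)
    have "card (T l) = B ^ \<omega> l" for l by (simp add: T_def distrib_right nat_power_eq)
    then have cardbox: "card box = B ^ E"
      unfolding box_def E_def using finL by (simp add: card_PiE power_sum)
    have range: "w g \<in> {1..int N}" if "g \<in> box" "w \<in> W" for g w
    proof -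
      have gl: "int (p l) * int B ^ \<omega> l < g l \<and> g l \<le> (int (p l) + 1) * int B ^ \<omega> l" if "l \<in> L" for l
        using \<open>g \<in> box\<close> that by (auto simp: box_def T_def PiE_iff)
      have "1 \<le> w (dilate 1 g)" using p[rule_format, of 1 "int B" g w] gl B that(2) by simp
      moreover have "\<bar>g l\<bar> \<le> int (M + 1) * int B ^ \<omega> l" if l: "l \<in> L" for l
      proof -
        have "0 \<le> int (p l) * int B ^ \<omega> l" by simp
        then have "\<bar>g l\<bar> \<le> (int (p l) + 1) * int B ^ \<omega> l" using gl[OF l] by linarith
        also have "\<dots> \<le> int (M + 1) * int B ^ \<omega> l" using M[OF l] by (intro mult_right_mono) auto
        finally show ?thesis .
      qed
      then have "\<bar>w g\<bar> \<le> C0 * int B ^ k" using C0(2)[rule_format, of w "int B" g] that(2) B by simp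
      moreover have "C0 * int B ^ k \<le> int N"
      proof -
        have "C0 * int B ^ k = int (C * B ^ k)" using C0(1) by (simp add: C_def)
        also have "\<dots> \<le> int N" using N by (simp only: of_nat_le_iff)
        finally show ?thesis .
      qed
      ultimately show ?thesis by simp
    qed
    have "\<forall>n\<in>{1..int N}. \<exists>j. j \<in> {1..r} \<and> n \<in> Col j"
      using Col unfolding colouring_def by blast
    then obtain \<kappa> where \<kappa>: "\<And>n. n \<in> {1..int N} \<Longrightarrow> \<kappa> n \<in> {1..r} \<and> n \<in> Col (\<kappa> n)" by metis
    have fincol: "finite (Col j)" if "j \<in> {1..r}" for j
    proof (rule finite_subset)
      show "Col j \<subseteq> {1..int N}" using Col that unfolding colouring_def by blast
    qed simp
    define Mono where "Mono = (\<Union>j\<in>{1..r}. solutions_in s t a b (Col j))"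
    have finMono: "finite Mono" unfolding Mono_def by (intro finite_UN_I finite_solutions_in fincol) simp
    define \<Phi> where "\<Phi> XY g = (\<lambda>i\<in>{1..s}. fst XY i g, \<lambda>j\<in>{1..t}. snd XY j g)"
      for XY :: "(nat \<Rightarrow> (nat list \<Rightarrow> int) \<Rightarrow> int) \<times> (nat \<Rightarrow> (nat list \<Rightarrow> int) \<Rightarrow> int)" and g
    have cover: "box \<subseteq> (\<Union>XY\<in>P. {g \<in> box. \<Phi> XY g \<in> Mono})"
    proof
      fix g assume g: "g \<in> box"
      have "\<exists>X Y \<gamma>. solution_pattern L \<omega> W X Y \<and>
          (\<forall>i\<in>{1..s}. \<kappa> (X i g) = \<gamma>) \<and> (\<forall>j\<in>{1..t}. \<kappa> (Y j g) = \<gamma>)"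
        by (rule Ramsey_propertyD[OF Ramsey, of "{1..r}"]) (use \<kappa> range[OF g] in auto)
      then obtain X Y \<gamma> where XY: "solution_pattern L \<omega> W X Y"
        "\<forall>i\<in>{1..s}. \<kappa> (X i g) = \<gamma>" "\<forall>j\<in>{1..t}. \<kappa> (Y j g) = \<gamma>" by blast
      have XW: "X i \<in> W" if "i \<in> {1..s}" for i using XY(1) that by (simp add: solution_pattern_def)
      have YW: "Y j \<in> W" if "j \<in> {1..t}" for j using XY(1) that by (simp add: solution_pattern_def)
      have i0: "i0 \<in> {1..s}" using I by blast
      then have "\<kappa> (X i0 g) = \<gamma>" using XY(2) by blast
      then have \<gamma>: "\<gamma> \<in> {1..r}"
        using \<kappa>[OF range[OF g XW[OF i0]]] by blast
      have "X i g \<in> Col \<gamma>" if "i \<in> {1..s}" for i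
        using \<kappa>[OF range[OF g XW[OF that]]] XY(2) that by metis
      moreover have "Y j g \<in> Col \<gamma>" if "j \<in> {1..t}" for j
        using \<kappa>[OF range[OF g YW[OF that]]] XY(3) that by metis
      moreover have "(\<Sum>i\<in>{1..s}. a i * X i g) = (\<Sum>j\<in>{1..t}. b j * (Y j g)\<^sup>2)"
        using XY(1) by (simp add: solution_pattern_def)
      moreover have "(\<Sum>i\<in>{1..s}. a i * (\<lambda>i\<in>{1..s}. X i g) i) = (\<Sum>i\<in>{1..s}. a i * X i g)"
        "(\<Sum>j\<in>{1..t}. b j * ((\<lambda>j\<in>{1..t}. Y j g) j)\<^sup>2) = (\<Sum>j\<in>{1..t}. b j * (Y j g)\<^sup>2)"
        by (rule sum.cong; simp)+
      ultimately have "(\<lambda>i\<in>{1..s}. X i g, \<lambda>j\<in>{1..t}. Y j g) \<in> solutions_in s t a b (Col \<gamma>)"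
        unfolding solutions_in_def solutions_def by (simp del: restrict_apply)
      moreover have "\<Phi> (restrict X {1..s}, restrict Y {1..t}) g = (\<lambda>i\<in>{1..s}. X i g, \<lambda>j\<in>{1..t}. Y j g)"
        by (auto simp: \<Phi>_def fun_eq_iff)
      ultimately have "\<Phi> (restrict X {1..s}, restrict Y {1..t}) g \<in> solutions_in s t a b (Col \<gamma>)"
        by simp
      moreover have "(restrict X {1..s}, restrict Y {1..t}) \<in> P"
        using XW YW XY(1) unfolding P_def by (simp add: solution_pattern_restrict[unfolded One_nat_def])
      ultimately show "g \<in> (\<Union>XY\<in>P. {g \<in> box. \<Phi> XY g \<in> Mono})"
        using g \<gamma> unfolding Mono_def by blast
    qed
    have fibre: "card {g \<in> box. \<Phi> XY g \<in> Mono} * B ^ exponent \<le> card Mono * B ^ E" if XY: "XY \<in> P" for XY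
    proof -
      obtain X Y where xy: "XY = (X, Y)" by force
      obtain J where J: "J \<subseteq> L" "exponent \<le> (\<Sum>l\<in>J. \<omega> l)" "determines J (X ` {1..s} \<union> Y ` {1..t})"
        using XY unfolding xy P_def solution_pattern_def by blast
      have "card {g \<in> box. \<Phi> XY g = \<mu>} * B ^ exponent \<le> B ^ E" for \<mu>
        unfolding E_def
      proof (rule card_determined_fibre[OF finL J(1,3,2) B, of _ p])
        show "{g \<in> box. \<Phi> XY g = \<mu>} \<subseteq> PiE L (\<lambda>l. {int (p l) * int B ^ \<omega> l<..(int (p l) + 1) * int B ^ \<omega> l})"
          by (auto simp: box_def T_def)
        fix f g g' assume f: "f \<in> X ` {1..s} \<union> Y ` {1..t}"
          and "g \<in> {g \<in> box. \<Phi> XY g = \<mu>}" "g' \<in> {g \<in> box. \<Phi> XY g = \<mu>}"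
        then have "\<Phi> XY g = \<Phi> XY g'" by simp
        then have eq: "(\<lambda>i\<in>{1..s}. X i g) = (\<lambda>i\<in>{1..s}. X i g')" "(\<lambda>j\<in>{1..t}. Y j g) = (\<lambda>j\<in>{1..t}. Y j g')"
          by (simp_all add: \<Phi>_def xy)
        show "f g = f g'"
          using f
        proof
          assume "f \<in> X ` {1..s}"
          then obtain i where "i \<in> {1..s}" "f = X i" by blast
          then show ?thesis using fun_cong[OF eq(1), of i] by simp
        next
          assume "f \<in> Y ` {1..t}"
          then obtain j where "j \<in> {1..t}" "f = Y j" by blast
          then show ?thesis using fun_cong[OF eq(2), of j] by simp
        qed
      qed
      then have "(\<Sum>\<mu>\<in>Mono. card {g \<in> box. \<Phi> XY g = \<mu>} * B ^ exponent) \<le> (\<Sum>\<mu>\<in>Mono. B ^ E)"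
        by (intro sum_mono)
      moreover have "card {g \<in> box. \<Phi> XY g \<in> Mono} \<le> (\<Sum>\<mu>\<in>Mono. card {g \<in> box. \<Phi> XY g = \<mu>})"
      proof -
        have eq: "{g \<in> box. \<Phi> XY g \<in> Mono} = (\<Union>\<mu>\<in>Mono. {g \<in> box. \<Phi> XY g = \<mu>})" by blast
        show ?thesis unfolding eq by (rule card_UN_le[OF finMono])
      qed
      then have "card {g \<in> box. \<Phi> XY g \<in> Mono} * B ^ exponent
          \<le> (\<Sum>\<mu>\<in>Mono. card {g \<in> box. \<Phi> XY g = \<mu>}) * B ^ exponent" by (rule mult_right_mono) simp
      ultimately show ?thesis by (simp add: sum_distrib_right)
    qed
    have "B ^ E * B ^ exponent \<le> (\<Sum>XY\<in>P. card {g \<in> box. \<Phi> XY g \<in> Mono}) * B ^ exponent"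
    proof (rule mult_right_mono)
      have "card box \<le> card (\<Union>XY\<in>P. {g \<in> box. \<Phi> XY g \<in> Mono})"
        by (rule card_mono[OF _ cover]) (use finP finbox in auto)
      also have "\<dots> \<le> (\<Sum>XY\<in>P. card {g \<in> box. \<Phi> XY g \<in> Mono})" by (rule card_UN_le[OF finP])
      finally show "B ^ E \<le> (\<Sum>XY\<in>P. card {g \<in> box. \<Phi> XY g \<in> Mono})" using cardbox by simp
    qed simp
    also have "\<dots> = (\<Sum>XY\<in>P. card {g \<in> box. \<Phi> XY g \<in> Mono} * B ^ exponent)" by (rule sum_distrib_right)
    also have "\<dots> \<le> (\<Sum>XY\<in>P. card Mono * B ^ E)" by (rule sum_mono[OF fibre])
    also have "\<dots> = B ^ E * (card P * card Mono)" by simp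
    finally have "B ^ exponent \<le> card P * card Mono" using B by simp
    also have "\<dots> \<le> card P * (\<Sum>j\<in>{1..r}. card (solutions_in s t a b (Col j)))"
      unfolding Mono_def by (rule mult_left_mono[OF card_UN_le]) simp_all
    finally have main: "B ^ exponent \<le> card P * (\<Sum>j\<in>{1..r}. card (solutions_in s t a b (Col j)))" .
    have r: "{1..r} \<noteq> {}"
    proof
      assume "{1..r} = {}"
      then have "B ^ exponent \<le> 0" using main by simp
      then show False using B by simp
    qed
    define m where "m = Max ((\<lambda>j. card (solutions_in s t a b (Col j))) ` {1..r})"
    have "m \<in> (\<lambda>j. card (solutions_in s t a b (Col j))) ` {1..r}"
      unfolding m_def using r by (intro Max_in) auto
    then obtain j where j: "j \<in> {1..r}" "m = card (solutions_in s t a b (Col j))" by blast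
    have "(\<Sum>j\<in>{1..r}. card (solutions_in s t a b (Col j))) \<le> (\<Sum>j\<in>{1..r}. m)"
      by (rule sum_mono) (simp add: m_def)
    then have "card P * (\<Sum>j\<in>{1..r}. card (solutions_in s t a b (Col j))) \<le> card P * (r * m)"
      by (intro mult_left_mono) auto
    from order_trans[OF main this] have "B ^ exponent \<le> (card P * r) * m"
      by (simp only: mult.assoc)
    then show ?thesis using j(1) unfolding j(2) by (rule bexI)
  qed
  have "C \<ge> 1" using C0(1) by (simp add: C_def)
  then show ?thesis
    by (intro exI[of _ C] exI[of _ "card P * r"] conjI allI impI) (assumption, rule at_scale)
qed

text \<open>The scale \<open>B\<close> is chosen as large as possible with \<open>C * B ^ (2 ^ r) \<le> N\<close>; rounding it down to an integer
at most halves it.\<close>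

lemma many_monochromatic_solutions:
  "\<exists>c>0. \<exists>N0. \<forall>N\<ge>N0. \<forall>Col. colouring r {1..int N} Col \<longrightarrow>
    (\<exists>j\<in>{1..r}. c * real N powr (real exponent / 2 ^ r) \<le> solution_count s t a b (Col j))"
proof -
  obtain L \<omega> W where "Ramsey_system r L \<omega> (2 ^ r) W" using Ramsey_system_exists by blast
  from many_solutions_at_scale[OF this] obtain C D :: nat where C: "C \<ge> 1" and
    many: "\<And>B N Col. B \<ge> 1 \<Longrightarrow> C * B ^ (2 ^ r) \<le> N \<Longrightarrow> colouring r {1..int N} Col \<Longrightarrow>
    \<exists>j\<in>{1..r}. B ^ exponent \<le> D * card (solutions_in s t a b (Col j))" by blast
  define c where "c = (1 / 2) ^ exponent * (1 / real C) powr (real exponent / 2 ^ r) / (real D + 1)"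
  have "c > 0" using C by (simp add: c_def)
  moreover have "\<exists>j\<in>{1..r}. c * real N powr (real exponent / 2 ^ r) \<le> solution_count s t a b (Col j)"
    if N: "N \<ge> C" and Col: "colouring r {1..int N} Col" for N Col
  proof -
    define \<rho> where "\<rho> = (real N / real C) powr (1 / 2 ^ r)"
    have q: "real N / real C \<ge> 1" using N C by simp
    then have \<rho>: "\<rho> \<ge> 1" unfolding \<rho>_def by (intro ge_one_powr_ge_zero) auto
    have pow: "\<rho> ^ n = (real N / real C) powr (real n / 2 ^ r)" for n
    proof -
      have "\<rho> ^ n = \<rho> powr real n" using \<rho> by (intro powr_realpow[symmetric]) simp
      also have "\<dots> = (real N / real C) powr (1 / 2 ^ r * real n)" unfolding \<rho>_def by (rule powr_powr)
      finally show ?thesis by simp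
    qed
    define B where "B = nat \<lfloor>\<rho>\<rfloor>"
    have B: "B \<ge> 1" using \<rho> by (simp add: B_def le_nat_iff)
    have B_le: "real B \<le> \<rho>" using \<rho> by (simp add: B_def)
    have "\<rho> < real B + 1" using \<rho> unfolding B_def by linarith
    then have B_ge: "\<rho> / 2 \<le> real B" using B by linarith
    have "real B ^ (2 ^ r) \<le> \<rho> ^ (2 ^ r)" using B_le by (intro power_mono) auto
    also have "\<dots> = real N / real C"
      using q by (simp add: pow)
    finally have "real C * real B ^ (2 ^ r) \<le> real N" using C by (simp add: field_simps)
    then have "real (C * B ^ (2 ^ r)) \<le> real N" by simp
    then have "C * B ^ (2 ^ r) \<le> N" by (simp only: of_nat_le_iff)
    from many[OF B this Col] obtain j where j: "j \<in> {1..r}"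
      "B ^ exponent \<le> D * card (solutions_in s t a b (Col j))" by blast
    have "Col j \<subseteq> {1..int N}" using Col j(1) unfolding colouring_def by blast
    then have fin: "finite (Col j)" by (rule finite_subset) simp
    have "(1 / 2) ^ exponent * (real N / real C) powr (real exponent / 2 ^ r) = (\<rho> / 2) ^ exponent"
      by (simp add: power_divide pow)
    also have "\<dots> \<le> real B ^ exponent" using B_ge \<rho> by (intro power_mono) auto
    also have "\<dots> = real (B ^ exponent)" by simp
    also have "\<dots> \<le> real (D * card (solutions_in s t a b (Col j)))" using j(2) by (simp only: of_nat_le_iff)
    also have "\<dots> \<le> (real D + 1) * solution_count s t a b (Col j)"
      by (simp add: solution_count_eq_card[OF fin] algebra_simps)
    finally have "(1 / 2) ^ exponent * (real N / real C) powr (real exponent / 2 ^ r) / (real D + 1)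
        \<le> solution_count s t a b (Col j)"
      by (simp add: divide_le_eq mult.commute)
    moreover have "(real N / real C) powr (real exponent / 2 ^ r) =
        (1 / real C) powr (real exponent / 2 ^ r) * real N powr (real exponent / 2 ^ r)"
      by (simp flip: powr_mult)
    ultimately show ?thesis using j(1) by (intro bexI[of _ j]) (simp_all add: c_def)
  qed
  ultimately show ?thesis by (intro exI[of _ c] conjI exI[of _ C]) blast+
qed

end

text \<open>There are finitely many sets \<open>I\<close>, so the constants can be chosen uniformly. A set \<open>I\<close> with
vanishing coefficient sum has at least two elements since no coefficient is 0.\<close>

theorem theorem1p3:
  fixes s t :: nat and a b :: "nat \<Rightarrow> int"
  assumes "s \<ge> 1" and "t \<ge> 1"
    and "\<forall>i\<in>{1..s}. a i \<noteq> 0" and "\<forall>j\<in>{1..t}. b j \<noteq> 0"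
  shows "\<forall>r::nat. r \<ge> 1 \<longrightarrow>
    (\<exists>(c::real) (\<tau>::nat \<Rightarrow> real).
       c > 0 \<and> (\<forall>N. \<tau> N \<ge> 0) \<and> \<tau> \<longlonglongrightarrow> 0 \<and>
       (\<forall>I. I \<subseteq> {1..s} \<and> I \<noteq> {} \<and> (\<Sum>i\<in>I. a i) = 0 \<longrightarrow>
         (\<forall>N::nat. N \<ge> 1 \<longrightarrow>
           (\<forall>C. colouring r {1..int N} C \<longrightarrow>
             (\<exists>j\<in>{1..r}. solution_count s t a b (C j) \<ge>
                c * real N powr ((real (card I) + real s + real t - 2) / 2 ^ r) * (1 - \<tau> N))))))"
proof (intro allI impI)
  fix r :: nat assume r: "r \<ge> 1"
  define \<I> where "\<I> = {I. I \<subseteq> {1..s} \<and> I \<noteq> {} \<and> (\<Sum>i\<in>I. a i) = 0}"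
  have fin\<I>: "finite \<I>" unfolding \<I>_def by (rule finite_subset[of _ "Pow {1..s}"]) auto
  have "\<exists>c>0. \<exists>N0. \<forall>N\<ge>N0. \<forall>C. colouring r {1..int N} C \<longrightarrow>
    (\<exists>j\<in>{1..r}. c * real N powr ((real (card I) + real s + real t - 2) / 2 ^ r) \<le> solution_count s t a b (C j))"
    if "I \<in> \<I>" for I
  proof -
    have I: "I \<subseteq> {1..s}" "I \<noteq> {}" "(\<Sum>i\<in>I. a i) = 0" using that by (auto simp: \<I>_def)
    have finI: "finite I" using I(1) finite_subset by blast
    obtain i0 where i0: "i0 \<in> I" using I(2) by blast
    have "I \<noteq> {i0}" using I assms(3) by auto
    then obtain i1 where i1: "i1 \<in> I" "i0 \<noteq> i1" using i0 by blast
    interpret translation_invariant_equation s t a b I i0 i1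
      by standard (use I i0 i1 assms(3) in auto)
    have "card {i0, i1} \<le> card I" by (rule card_mono[OF finI]) (use i0 i1 in auto)
    then have "real exponent = real (card I) + real s + real t - 2"
      using i1 by (simp add: exponent_def)
    then show ?thesis using many_monochromatic_solutions[of r] by simp
  qed
  then obtain c N0 where c: "\<And>I. I \<in> \<I> \<Longrightarrow> c I > (0::real)" and
    N0: "\<And>I N C. I \<in> \<I> \<Longrightarrow> N \<ge> N0 I \<Longrightarrow> colouring r {1..int N} C \<Longrightarrow>
    \<exists>j\<in>{1..r}. c I * real N powr ((real (card I) + real s + real t - 2) / 2 ^ r) \<le> solution_count s t a b (C j)"
    by metis
  define c' where "c' = Min (insert 1 (c ` \<I>))"
  define N' where "N' = Max (insert 0 (N0 ` \<I>))"
  define \<tau> where "\<tau> N = (if N < N' then 1 else 0 :: real)" for N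
  have "c' > 0" unfolding c'_def using fin\<I> c by auto
  moreover have "\<forall>N. \<tau> N \<ge> 0" by (simp add: \<tau>_def)
  moreover have "\<tau> \<longlonglongrightarrow> 0"
    by (rule tendsto_eventually) (auto simp: \<tau>_def eventually_sequentially intro!: exI[of _ N'])
  moreover have "\<exists>j\<in>{1..r}. solution_count s t a b (C j) \<ge>
      c' * real N powr ((real (card I) + real s + real t - 2) / 2 ^ r) * (1 - \<tau> N)"
    if I: "I \<in> \<I>" and C: "colouring r {1..int N} C" for I N C
  proof (cases "N < N'")
    case True
    have "0 \<le> solution_count s t a b (C 1)"
      unfolding solution_count_def by (rule infsum_nonneg) (auto intro!: mult_nonneg_nonneg prod_nonneg)
    then show ?thesis using True r by (intro bexI[of _ 1]) (auto simp: \<tau>_def)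
  next
    case False
    have "N0 I \<le> N'" unfolding N'_def using fin\<I> I by (intro Max_ge) auto
    then obtain j where j: "j \<in> {1..r}"
      "c I * real N powr ((real (card I) + real s + real t - 2) / 2 ^ r) \<le> solution_count s t a b (C j)"
      using N0[OF I _ C] False by force
    have "c' \<le> c I" unfolding c'_def using fin\<I> I by (intro Min_le) auto
    then have "c' * real N powr ((real (card I) + real s + real t - 2) / 2 ^ r)
        \<le> c I * real N powr ((real (card I) + real s + real t - 2) / 2 ^ r)"
      by (intro mult_right_mono) auto
    then show ?thesis using j False by (intro bexI[of _ j]) (auto simp: \<tau>_def)
  qed
  ultimately show "\<exists>(c::real) (\<tau>::nat \<Rightarrow> real).
       c > 0 \<and> (\<forall>N. \<tau> N \<ge> 0) \<and> \<tau> \<longlonglongrightarrow> 0 \<and>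
       (\<forall>I. I \<subseteq> {1..s} \<and> I \<noteq> {} \<and> (\<Sum>i\<in>I. a i) = 0 \<longrightarrow>
         (\<forall>N::nat. N \<ge> 1 \<longrightarrow>
           (\<forall>C. colouring r {1..int N} C \<longrightarrow>
             (\<exists>j\<in>{1..r}. solution_count s t a b (C j) \<ge>
                c * real N powr ((real (card I) + real s + real t - 2) / 2 ^ r) * (1 - \<tau> N)))))"
    by (intro exI[of _ c'] exI[of _ \<tau>] conjI) (auto simp: \<I>_def)
qed

end
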